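(* Let $d\ge 2$, $L>0$, $g>0$, $\rho_+>\rho_->0$, and $A=(\rho_+-\rho_-)/(\rho_++\rho_-)$. Let $(\rho,\mathbf{u})$ be a classical solution on $[0,L]^{d-1}\times\mathbb{R}$ (periodic in the first $d-1$ variables) of the system $$\rho_t+\mathbf{u}\cdot\nabla\rho-\Delta\rho=0,$$ $$\rho\big(\mathbf{u}_t+(\mathbf{u}\cdot\nabla)\mathbf{u}\big)-(\nabla\rho\cdot\nabla)\mathbf{u}+\nabla p+\rho g\,\mathbf{e}_z=0,\qquad \nabla\cdot\mathbf{u}=0,$$ with initial data such that the initial potential energy $E_p(0)$, the initial mixing entropy $H(0)$ and the initial mean perimeter $P(0)$ are finite. Then $$\limsup_{t\to+\infty}\frac{E_p(t)}{g(Agt^2)^2}\le\frac{1}{24(1-A^2)},$$ $$\limsup_{t\to+\infty}\frac{H(t)}{Agt^2}\le\frac{1}{6\sqrt{1-A^2}},$$ and $$\limsup_{t\to+\infty}\frac{1}{(Agt^2)^2}\int_0^tP^2(\tau)\,d\tau\le\frac{\pi}{36(1-A^2)}.$$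
   Context: Points of the strip are $x=(y,z)$ with $y\in[0,L]^{d-1}$, $z\in\mathbb{R}$; $\mathbf{e}_z$ is the unit vector in the $z$ direction; all functions are periodic in $y$. The unknowns are the scalar density $\rho(x,t)$, the velocity $\mathbf{u}(x,t)\in\mathbb{R}^d$, and the pressure $p(x,t)$. Reference state: $\mathbf{u}_0=0$, $\rho_0(z)=\rho_+$ for $z\ge 0$ and $\rho_0(z)=\rho_-$ for $z<0$. Throughout, the initial datum is a perturbation of this reference state. Normalized integral: $⨍ f\,dx=\int_{\mathbb{R}}\frac{1}{L^{d-1}}\int_{[0,L]^{d-1}}f(y,z)\,dy\,dz$ (here ⨍ denotes the integral over the strip divided by $L^{d-1}$). Bulk quantities: $E_p(t)=\frac{1}{\rho_+-\rho_-}⨍(\rho_0(z)-\rho(x,t))\,g z\,dx$ (negative of the potential energy), $E_k(t)=\frac{1}{2(\rho_+-\rho_-)}⨍\rho|\mathbf{u}|^2\,dx$ (kinetic energy), $H(t)=\frac{1}{(\rho_+-\rho_-)^2}⨍(\rho_+-\rho)(\rho-\rho_-)\,dx$, $S(t)=-⨍\big[\frac{\rho_+-\rho}{\rho_+-\rho_-}\log\frac{\rho_+-\rho}{\rho_+-\rho_-}+\frac{\rho-\rho_-}{\rho_+-\rho_-}\log\frac{\rho-\rho_-}{\rho_+-\rho_-}\big]dx$ (mixing entropies), $P(t)=\frac{1}{\rho_+-\rho_-}⨍|\nabla\rho|\,dx$ (mean perimeter). Convention on classical solutions: $(\rho,\mathbf{u},p)$ is smooth enough for the equations to hold pointwise for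 all $t>0$ (so the solution is global in time), periodic in $y$; $\rho\in[\rho_-,\rho_+]$, with $\rho\in(\rho_-,\rho_+)$ for $t>0$; $\rho\to\rho_\pm$ and $|\mathbf{u}|\to0$ as $z\to\pm\infty$; and the decay as $z\to\pm\infty$ is fast enough that the bulk quantities $E_p,E_k,H,S$ are finite and continuous for $t\ge0$, differentiable for $t>0$ by differentiating under the integral, and integrations by parts in $z$ produce no boundary terms at infinity other than those coming from $\rho\to\rho_\pm$ in $\int \rho_z\,dz=\rho_+-\rho_-$. *)

theory Defs
  imports "HOL-Analysis.Analysis"
begin

text \<open>
  A point is a pair \<open>x = (y, z)\<close> with \<open>y :: real ^ 'n\<close>, so the space dimension is
  \<open>d = CARD('n) + 1\<close>, which ranges over all \<open>d \<ge> 2\<close>. Functions live on the whole space and are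
  \<open>L\<close>-periodic in every coordinate of \<open>y\<close>; integrals are taken over one period cell.
\<close>

type_synonym 'n point = "(real ^ 'n) \<times> real"

definition e_z :: "'n::finite point" where
  "e_z = (0, 1)"

definition y_periodic :: "real \<Rightarrow> ('n::finite point \<Rightarrow> 'b) \<Rightarrow> bool" where
  "y_periodic L f \<longleftrightarrow> (\<forall>i y z. f (y + axis i L, z) = f (y, z))"

definition cell :: "real \<Rightarrow> (real ^ 'n::finite) set" where
  "cell L = cbox 0 (\<chi> i. L)"

definition strip :: "real \<Rightarrow> 'n::finite point set" where
  "strip L = cell L \<times> UNIV"

definition strip_integrable :: "real \<Rightarrow> ('n::finite point \<Rightarrow> real) \<Rightarrow> bool" where
  "strip_integrable L f \<longleftrightarrow> set_integrable lborel (strip L) f"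

definition strip_integral :: "real \<Rightarrow> ('n::finite point \<Rightarrow> real) \<Rightarrow> real" where
  "strip_integral L f = 1 / L ^ CARD('n) * (LINT x:strip L|lborel. f x)"


section \<open>Differential operators\<close>

definition grad :: "('a::euclidean_space \<Rightarrow> real) \<Rightarrow> 'a \<Rightarrow> 'a" where
  "grad f x = (\<Sum>b\<in>Basis. frechet_derivative f (at x) b *\<^sub>R b)"

definition divergence :: "('a::euclidean_space \<Rightarrow> 'a) \<Rightarrow> 'a \<Rightarrow> real" where
  "divergence v x = (\<Sum>b\<in>Basis. frechet_derivative v (at x) b \<bullet> b)"

definition laplacian :: "('a::euclidean_space \<Rightarrow> real) \<Rightarrow> 'a \<Rightarrow> real" where
  "laplacian f x =
    (\<Sum>b\<in>Basis. frechet_derivative (\<lambda>x'. frechet_derivative f (at x') b) (at x) b)"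

text \<open>\<open>(a \<cdot> \<nabla>) v\<close> at \<open>x\<close>, for a vector \<open>a\<close>.\<close>

definition dir_deriv :: "'a::euclidean_space \<Rightarrow> ('a \<Rightarrow> 'a) \<Rightarrow> 'a \<Rightarrow> 'a" where
  "dir_deriv a v x = frechet_derivative v (at x) a"

text \<open>The set \<open>S\<close> is meant to be open.\<close>

definition C1_on :: "('a::euclidean_space \<Rightarrow> 'b::real_normed_vector) \<Rightarrow> 'a set \<Rightarrow> bool" where
  "C1_on f S \<longleftrightarrow> (\<forall>x\<in>S. f differentiable (at x)) \<and>
     (\<forall>b\<in>Basis. continuous_on S (\<lambda>x. frechet_derivative f (at x) b))"


section \<open>Bulk quantities\<close>

definition ref_density :: "real \<Rightarrow> real \<Rightarrow> real \<Rightarrow> real" where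
  "ref_density rp rm z = (if z \<ge> 0 then rp else rm)"

text \<open>
  Each bulk quantity is the normalized integral of a function of the height \<open>z\<close>, the density
  value \<open>r\<close> and the velocity value \<open>v\<close>; the constant prefactors are put inside the integral.
  In the entropy, \<open>0 log 0 = 0\<close> holds because \<open>ln 0 = 0\<close>.
\<close>

type_synonym 'n bulk_fun = "real \<Rightarrow> real \<Rightarrow> 'n point \<Rightarrow> real"

definition potential :: "real \<Rightarrow> real \<Rightarrow> real \<Rightarrow> 'n::finite bulk_fun" where
  "potential g rp rm z r v = (ref_density rp rm z - r) * g * z / (rp - rm)"

definition kinetic :: "real \<Rightarrow> real \<Rightarrow> 'n::finite bulk_fun" where
  "kinetic rp rm z r v = r * (norm v)\<^sup>2 / (2 * (rp - rm))"

definition mixing :: "real \<Rightarrow> real \<Rightarrow> 'n::finite bulk_fun" where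
  "mixing rp rm z r v = (rp - r) * (r - rm) / (rp - rm)\<^sup>2"

definition entropy :: "real \<Rightarrow> real \<Rightarrow> 'n::finite bulk_fun" where
  "entropy rp rm z r v =
     - ((rp - r) / (rp - rm) * ln ((rp - r) / (rp - rm)) +
        (r - rm) / (rp - rm) * ln ((r - rm) / (rp - rm)))"

definition along ::
  "'n::finite bulk_fun \<Rightarrow> (real \<Rightarrow> 'n point \<Rightarrow> real) \<Rightarrow> (real \<Rightarrow> 'n point \<Rightarrow> 'n point) \<Rightarrow>
     real \<Rightarrow> 'n point \<Rightarrow> real" where
  "along e rho u t x = e (snd x) (rho t x) (u t x)"

definition bulk ::
  "real \<Rightarrow> 'n::finite bulk_fun \<Rightarrow> (real \<Rightarrow> 'n point \<Rightarrow> real) \<Rightarrow> (real \<Rightarrow> 'n point \<Rightarrow> 'n point) \<Rightarrow>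
     real \<Rightarrow> real" where
  "bulk L e rho u t = strip_integral L (along e rho u t)"

definition mean_perimeter ::
  "real \<Rightarrow> real \<Rightarrow> real \<Rightarrow> (real \<Rightarrow> 'n::finite point \<Rightarrow> real) \<Rightarrow> real \<Rightarrow> ennreal" where
  "mean_perimeter L rp rm rho t =
     (\<integral>\<^sup>+x\<in>strip L. ennreal (norm (grad (rho t) x)) \<partial>lborel) / ennreal ((rp - rm) * L ^ CARD('n))"

text \<open>
  The initial density need not be differentiable (it may be a sharp interface), so
  the integral of \<open>|\<nabla>\<rho>|\<close> at the initial time is understood as the total variation over a period,
  which is the same number for continuously differentiable densities.
\<close>

definition total_variation :: "real \<Rightarrow> ('n::finite point \<Rightarrow> real) \<Rightarrow> ennreal" where
  "total_variation L r =
     (SUP \<phi> \<in> {\<phi> :: 'n point \<Rightarrow> 'n point.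
                 y_periodic L \<phi> \<and> C1_on \<phi> UNIV \<and> (\<forall>x. norm (\<phi> x) \<le> 1) \<and>
                 (\<exists>R. \<forall>x. \<bar>snd x\<bar> > R \<longrightarrow> \<phi> x = 0)}.
        ennreal (LINT x:strip L|lborel. r x * divergence \<phi> x))"

definition initial_mean_perimeter ::
  "real \<Rightarrow> real \<Rightarrow> real \<Rightarrow> ('n::finite point \<Rightarrow> real) \<Rightarrow> ennreal" where
  "initial_mean_perimeter L rp rm r =
     total_variation L r / ennreal ((rp - rm) * L ^ CARD('n))"


section \<open>Classical solutions\<close>

definition smooth_solution ::
  "real \<Rightarrow> (real \<Rightarrow> 'n::finite point \<Rightarrow> real) \<Rightarrow> (real \<Rightarrow> 'n point \<Rightarrow> 'n point) \<Rightarrow>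
     (real \<Rightarrow> 'n point \<Rightarrow> real) \<Rightarrow> bool" where
  "smooth_solution g rho u p \<longleftrightarrow>
     C1_on (\<lambda>(t, x). rho t x) ({0<..} \<times> UNIV) \<and>
     (\<forall>b\<in>Basis. \<forall>t>0. \<forall>x. (\<lambda>x'. frechet_derivative (rho t) (at x') b) differentiable (at x)) \<and>
     (\<forall>b\<in>Basis. \<forall>c\<in>Basis. continuous_on ({0<..} \<times> UNIV)
        (\<lambda>(t, x). frechet_derivative (\<lambda>x'. frechet_derivative (rho t) (at x') b) (at x) c)) \<and>
     C1_on (\<lambda>(t, x). u t x) ({0<..} \<times> UNIV) \<and>
     (\<forall>t>0. C1_on (p t) UNIV) \<and>
     (\<forall>t>0. \<forall>x.
        vector_derivative (\<lambda>s. rho s x) (at t) + u t x \<bullet> grad (rho t) x - laplacian (rho t) x = 0 \<and>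
        rho t x *\<^sub>R (vector_derivative (\<lambda>s. u s x) (at t) + dir_deriv (u t x) (u t) x)
          - dir_deriv (grad (rho t) x) (u t) x + grad (p t) x + (rho t x * g) *\<^sub>R e_z = 0 \<and>
        divergence (u t) x = 0)"

text \<open>
  Finite and continuous up to the initial time, and for positive times differentiable by
  differentiating under the integral sign.
\<close>

definition regular_bulk ::
  "real \<Rightarrow> (real \<Rightarrow> 'n::finite point \<Rightarrow> real) \<Rightarrow> (real \<Rightarrow> 'n point \<Rightarrow> 'n point) \<Rightarrow>
     'n bulk_fun \<Rightarrow> bool" where
  "regular_bulk L rho u e \<longleftrightarrow>
     (\<forall>t\<ge>0. strip_integrable L (along e rho u t)) \<and>
     continuous_on {0..} (bulk L e rho u) \<and>
     (\<forall>t>0. strip_integrable L (\<lambda>x. deriv (\<lambda>s. along e rho u s x) t) \<and>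
        (bulk L e rho u has_real_derivative
           strip_integral L (\<lambda>x. deriv (\<lambda>s. along e rho u s x) t)) (at t))"

text \<open>
  The boundary term at infinity produced by integrating by parts in \<open>z\<close> is the limit of the flux
  through the horizontal sections; \<open>f\<close> is the vertical component of the flux.
\<close>

definition no_boundary_term :: "real \<Rightarrow> ('n::finite point \<Rightarrow> real) \<Rightarrow> bool" where
  "no_boundary_term L f \<longleftrightarrow>
     ((\<lambda>z. LINT y:cell L|lborel. f (y, z)) \<longlongrightarrow> 0) at_top \<and>
     ((\<lambda>z. LINT y:cell L|lborel. f (y, z)) \<longlongrightarrow> 0) at_bot"

text \<open>
  Substituting the equations into the time derivative of a bulk quantity with integrand \<open>e\<close>
  and integrating by parts produces the advective flux \<open>e u\<close>, the diffusive flux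
  \<open>(\<partial>e/\<partial>r) \<nabla>\<rho>\<close> and, for the kinetic energy only, the pressure flux \<open>p u\<close>.
\<close>

definition no_boundary_terms ::
  "real \<Rightarrow> (real \<Rightarrow> 'n::finite point \<Rightarrow> real) \<Rightarrow> (real \<Rightarrow> 'n point \<Rightarrow> 'n point) \<Rightarrow>
     'n bulk_fun \<Rightarrow> bool" where
  "no_boundary_terms L rho u e \<longleftrightarrow>
     (\<forall>t>0.
        no_boundary_term L (\<lambda>x. along e rho u t x * snd (u t x)) \<and>
        no_boundary_term L
          (\<lambda>x. deriv (\<lambda>r. e (snd x) r (u t x)) (rho t x) * snd (grad (rho t) x)))"

definition classical_solution ::
  "real \<Rightarrow> real \<Rightarrow> real \<Rightarrow> real \<Rightarrow> (real \<Rightarrow> 'n::finite point \<Rightarrow> real) \<Rightarrow>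
     (real \<Rightarrow> 'n point \<Rightarrow> 'n point) \<Rightarrow> (real \<Rightarrow> 'n point \<Rightarrow> real) \<Rightarrow> bool" where
  "classical_solution L g rp rm rho u p \<longleftrightarrow>
     smooth_solution g rho u p \<and>
     rho 0 \<in> borel_measurable borel \<and> u 0 \<in> borel_measurable borel \<and>
     (\<forall>t\<ge>0. y_periodic L (rho t) \<and> y_periodic L (u t)) \<and> (\<forall>t>0. y_periodic L (p t)) \<and>
     (\<forall>t\<ge>0. \<forall>x. rho t x \<in> {rm..rp}) \<and> (\<forall>t>0. \<forall>x. rho t x \<in> {rm<..<rp}) \<and>
     (\<forall>t\<ge>0. \<forall>y.
        ((\<lambda>z. rho t (y, z)) \<longlongrightarrow> rp) at_top \<and> ((\<lambda>z. rho t (y, z)) \<longlongrightarrow> rm) at_bot \<and>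
        ((\<lambda>z. norm (u t (y, z))) \<longlongrightarrow> 0) at_top \<and> ((\<lambda>z. norm (u t (y, z))) \<longlongrightarrow> 0) at_bot) \<and>
     (\<forall>e \<in> {potential g rp rm, kinetic rp rm, mixing rp rm, entropy rp rm}.
        regular_bulk L rho u e \<and> no_boundary_terms L rho u e) \<and>
     (\<forall>t>0. no_boundary_term L (\<lambda>x. p t x * snd (u t x)))"

end

theory Submission
  imports Defs "HOL-Analysis.Analysis" "HOL-Real_Asymp.Real_Asymp"
begin

text \<open>
  Integrating the equations gives \<open>E_p' = g + E_k'\<close>, where \<open>E_k'\<close> is \<open>- g / (rp - rm)\<close> times the
  normalized integral of \<open>\<rho> (u \<bullet> e_z)\<close>. Incompressibility lets one subtract a function \<open>c\<close> of the
  height from \<open>\<rho>\<close>; Cauchy-Schwarz then bounds \<open>E_k'\<close> by \<open>E_k\<close> and the integral of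
  \<open>(\<rho> - c)\<^sup>2 / \<rho>\<close>. For the optimal \<open>c\<close> this integral is controlled pointwise by the integrand of
  \<open>E_p\<close> plus an explicit profile in \<open>z\<close>, so that \<open>E_k' \<le> C E_p\<^sup>3\<^sup>/\<^sup>4\<close> up to lower order
  terms, with the sharp constant; the first bound follows by integration. The same kind of pointwise
  (Legendre) inequality bounds both mixing entropies by multiples of \<open>(E_p / g)\<^sup>1\<^sup>/\<^sup>2\<close>. Finally
  \<open>P\<^sup>2 \<le> S' H\<close> by Cauchy-Schwarz, and integrating in time with \<open>H\<close> replaced by its bound at the
  final time gives the estimate for the perimeter.
\<close>

section \<open>Optimal profiles\<close>

text \<open>The hypotheses control fluxes only through limits of their integrals over horizontal
  sections, and the divergences of these fluxes need not be integrable over the strip. Hence each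
  evolution law is an exact identity on slabs of height \<open>2 * n\<close>, followed by a limit,
  and a quantity such as the norm of the density gradient is bounded uniformly on slabs before its
  integral over the strip is known to be finite. Integrability also shapes the inequalities: each
  Cauchy-Schwarz or Legendre bound is applied pointwise, linearized by a free positive parameter, so
  that its right side combines integrable densities; the parameter is optimized only after
  integration. The power 3/4 is a sum of 1/2 and 1/4. The velocity contributes the square root of
  the kinetic energy, which the energy balance bounds by the potential energy up to a constant; the
  density contributes the fourth root of the potential energy. The profile bound for the density is
  exact when only the values \<open>rp\<close> and \<open>rm\<close> occur.\<close>

lemma nn_integral_scale:
  fixes f :: "real \<Rightarrow> real"
  assumes [measurable]: "f \<in> borel_measurable borel" and "l > 0"
    and "(\<integral>\<^sup>+x. ennreal (f x) \<partial>lborel) \<le> ennreal K"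
  shows "(\<integral>\<^sup>+x. ennreal (f (l * x)) \<partial>lborel) \<le> ennreal (K / l)"
proof -
  have "(\<integral>\<^sup>+x. ennreal (f x) \<partial>lborel) = ennreal l * (\<integral>\<^sup>+x. ennreal (f (l * x)) \<partial>lborel)"
    using nn_integral_real_affine[of "\<lambda>x. ennreal (f x)" l 0] assms(2) by simp
  hence "(\<integral>\<^sup>+x. ennreal (f (l * x)) \<partial>lborel) = ennreal (1 / l) * (\<integral>\<^sup>+x. ennreal (f x) \<partial>lborel)"
    using assms(2) by (simp add: mult.assoc[symmetric] ennreal_mult[symmetric])
  also have "\<dots> \<le> ennreal (1 / l) * ennreal K"
    by (intro mult_left_mono assms) auto
  also have "\<dots> = ennreal (K / l)"
    using assms(2) by (simp add: ennreal_mult'[symmetric])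
  finally show ?thesis .
qed

lemma nn_integral_abs_le:
  fixes f :: "real \<Rightarrow> real"
  assumes [measurable]: "f \<in> borel_measurable borel"
    and "(\<integral>\<^sup>+x. ennreal (f x) * indicator {0..} x \<partial>lborel) \<le> ennreal K" "K \<ge> 0"
  shows "(\<integral>\<^sup>+x. ennreal (f \<bar>x\<bar>) \<partial>lborel) \<le> ennreal (2 * K)"
proof -
  have "(\<integral>\<^sup>+x. ennreal (f \<bar>x\<bar>) \<partial>lborel) \<le>
      (\<integral>\<^sup>+x. ennreal (f x) * indicator {0..} x + ennreal (f (-x)) * indicator {0..} (-x) \<partial>lborel)"
    by (intro nn_integral_mono) (auto simp: indicator_def)
  also have "\<dots> = (\<integral>\<^sup>+x. ennreal (f x) * indicator {0..} x \<partial>lborel)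
        + (\<integral>\<^sup>+x. ennreal (f (-x)) * indicator {0..} (-x) \<partial>lborel)"
    by (rule nn_integral_add) auto
  also have "(\<integral>\<^sup>+x. ennreal (f (-x)) * indicator {0..} (-x) \<partial>lborel)
      = (\<integral>\<^sup>+x. ennreal (f x) * indicator {0..} x \<partial>lborel)"
    using nn_integral_real_affine[of "\<lambda>x. ennreal (f x) * indicator {0..} x" "-1" 0] by simp
  also have "(\<integral>\<^sup>+x. ennreal (f x) * indicator {0..} x \<partial>lborel)
      + (\<integral>\<^sup>+x. ennreal (f x) * indicator {0..} x \<partial>lborel) \<le> ennreal K + ennreal K"
    by (intro add_mono assms)
  also have "\<dots> = ennreal (2 * K)" using assms(3) by (simp add: ennreal_plus[symmetric] del: ennreal_plus)
  finally show ?thesis .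
qed

section \<open>Dual profile of the mixing entropy \<open>H\<close>\<close>

text \<open>Legendre duality in \<open>a\<close>: for \<open>0 \<le> x \<le> 1\<close> the
  difference \<open>a * (1 - a) - x * (1 - a)\<close> is largest at \<open>a = (1 + x) / 2\<close>,
  with value \<open>(1 - x)\<^sup>2 / 4\<close>; for \<open>x \<ge> 1\<close> its maximum 0 sits at
  the endpoint \<open>a = 1\<close>. Replacing \<open>(a, x)\<close> by \<open>(1 - a, - x)\<close>
  covers negative \<open>x\<close>.\<close>

lemma mixing_le_profile:
  fixes a x :: real
  assumes "0 \<le> a" "a \<le> 1"
  shows "a * (1 - a) \<le> x * ((if x \<ge> 0 then 1 else 0) - a) + (max 0 (1 - \<bar>x\<bar>))\<^sup>2 / 4"
proof -
  have *: "b * (1 - b) \<le> y * (1 - b) + (max 0 (1 - y))\<^sup>2 / 4" if "0 \<le> b" "b \<le> 1" "y \<ge> 0" for b y :: real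
  proof (cases "y \<le> 1")
    case True
    have "y * (1 - b) + (1 - y)\<^sup>2 / 4 - b * (1 - b) = ((1 - y) / 2 - (1 - b))\<^sup>2"
      by (simp add: power2_eq_square field_simps)
    also have "\<dots> \<ge> 0" by simp
    finally show ?thesis using True by (simp add: max_def)
  next
    case False
    have "b * (1 - b) \<le> y * (1 - b)" using that False by (intro mult_right_mono) auto
    thus ?thesis using False by (simp add: max_def)
  qed
  show ?thesis
  proof (cases "x \<ge> 0")
    case True thus ?thesis using *[of a x] assms by simp
  next
    case False thus ?thesis using *[of "1 - a" "-x"] assms by (simp add: algebra_simps)
  qed
qed

lemma mixing_profile_integral:
  "(\<integral>\<^sup>+x. ennreal ((max 0 (1 - \<bar>x\<bar>))\<^sup>2 / 4) \<partial>lborel) \<le> ennreal (1 / 6)"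
proof -
  have "(\<integral>\<^sup>+x. ennreal ((max 0 (1 - x))\<^sup>2 / 4) * indicator {0..} x \<partial>lborel)
     = (\<integral>\<^sup>+x. ennreal ((1 - x)\<^sup>2 / 4) * indicator {0..1} x \<partial>lborel)"
    by (intro nn_integral_cong) (auto simp: indicator_def max_def)
  also have "\<dots> = ennreal (- ((1 - 1) ^ 3) / 12 - (- ((1 - 0) ^ 3) / 12))"
  proof (rule nn_integral_FTC_Icc)
    show "((\<lambda>x. - ((1 - x) ^ 3) / 12) has_real_derivative (1 - x)\<^sup>2 / 4) (at x)" for x :: real
      by (auto intro!: derivative_eq_intros simp: power2_eq_square field_simps)
  qed auto
  finally show ?thesis
    using nn_integral_abs_le[of "\<lambda>x. (max 0 (1 - x))\<^sup>2 / 4" "1/12"] by simp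
qed

section \<open>Dual profile of the logarithmic entropy \<open>S\<close> and its integral\<close>

text \<open>Gibbs' inequality against the two-point distribution with weights \<open>1 / Z\<close>
  and \<open>exp (-y) / Z\<close>. Equality holds at \<open>b = 1 / Z\<close>, so
  \<open>ln Z\<close> is the exact Legendre transform of the binary entropy.\<close>

lemma binary_entropy_le_log_sum_exp:
  fixes b y :: real
  assumes "0 \<le> b" "b \<le> 1"
  shows "- (b * ln b + (1 - b) * ln (1 - b)) \<le> y * (1 - b) + ln (1 + exp (-y))"
proof -
  define Z where "Z = 1 + exp (-y)"
  have Z: "Z > 0" "exp (-y) > 0" unfolding Z_def by (auto intro: add_pos_pos)
  have gibbs: "c * ln (q / c) \<le> q - c" if "c \<ge> 0" "q > 0" for c q :: real
  proof (cases "c = 0")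
    case False
    have "c * ln (q / c) \<le> c * (q / c - 1)"
      using that False by (intro mult_left_mono ln_le_minus_one) auto
    also have "c * (q / c - 1) = q - c" using False by (simp add: algebra_simps)
    finally show ?thesis .
  qed (use that in auto)
  have l: "c * ln (q / c) = c * ln q - c * ln c" if "c \<ge> 0" "q > 0" for c q :: real
    using that by (cases "c = 0") (auto simp: ln_div algebra_simps)
  have "b * ln ((1 / Z) / b) + (1 - b) * ln ((exp (-y) / Z) / (1 - b)) \<le> (1 / Z - b) + (exp (-y) / Z - (1 - b))"
    using assms Z by (intro add_mono gibbs) auto
  also have "\<dots> = (1 + exp (-y)) / Z - 1" by (simp add: add_divide_distrib)
  also have "\<dots> = 0" using Z unfolding Z_def by (metis diff_self divide_self_if less_irrefl)
  finally have "b * ln (1 / Z) - b * ln b + ((1 - b) * ln (exp (-y) / Z) - (1 - b) * ln (1 - b)) \<le> 0"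
    using assms Z by (simp add: l del: divide_divide_eq_left)
  moreover have "ln (1 / Z) = - ln Z" "ln (exp (-y) / Z) = - y - ln Z"
    using Z by (auto simp: ln_div)
  ultimately show ?thesis by (simp add: Z_def[symmetric] algebra_simps)
qed

lemma entropy_le_profile:
  fixes a x :: real
  assumes "0 \<le> a" "a \<le> 1"
  shows "- (a * ln a + (1 - a) * ln (1 - a))
     \<le> x * ((if x \<ge> 0 then 1 else 0) - a) + ln (1 + exp (- \<bar>x\<bar>))"
proof (cases "x \<ge> 0")
  case True thus ?thesis using binary_entropy_le_log_sum_exp[of a x] assms by simp
next
  case False thus ?thesis using binary_entropy_le_log_sum_exp[of "1 - a" "-x"] assms by (simp add: algebra_simps)
qed

text \<open>Expand \<open>- ln (1 - w)\<close> in powers of \<open>w = exp (- x)\<close> and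
  integrate term by term, which nonnegativity permits. The term with exponent \<open>n + 1\<close>
  contributes \<open>1 / (n + 1)\<^sup>2\<close>, and Euler's sum of the inverse squares gives the
  value.\<close>

lemma nn_integral_ln_one_minus_exp:
  "(\<integral>\<^sup>+x. ennreal (- ln (1 - exp (- x))) * indicator {0<..} x \<partial>lborel) = ennreal (pi\<^sup>2 / 6)"
proof -
  let ?h = "\<lambda>n x. ennreal (exp (- (real n + 1) * x) / (real n + 1)) * indicator {0..} (x::real)"
  have s: "(\<lambda>n. exp (- (real n + 1) * x) / (real n + 1)) sums (- ln (1 - exp (-x)))"
    if "x > 0" for x :: real
  proof -
    have e: "0 < exp (-x)" "exp (-x) < 1" using that by auto
    have "(\<lambda>n. (-1) ^ n * (1 / real (n + 1)) * (- exp (-x)) ^ Suc n) sums ln (1 + (- exp (-x)))"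
    proof -
      have "ln (1 + (- exp (-x))) = (\<Sum>n. (-1) ^ n * (1 / real (n + 1)) * (1 + (- exp (-x)) - 1) ^ Suc n)"
        by (rule ln_series) (use e in \<open>auto simp: less_trans[of "-1" 0]\<close>)
      moreover have "summable (\<lambda>n. (-1) ^ n * (1 / real (n + 1)) * (- exp (-x)) ^ Suc n)"
      proof (rule summable_comparison_test')
        show "summable (\<lambda>n. exp (-x) ^ n)" using e by (intro summable_geometric) auto
        fix n :: nat assume "n \<ge> 0"
        have "norm ((-1) ^ n * (1 / real (n + 1)) * (- exp (-x)) ^ Suc n) = (exp (-x) / (real n + 1)) * exp (-x) ^ n"
          by (simp add: abs_mult power_abs)
        also have "exp (-x) \<le> real n + 1" using e by linarith
        hence "(exp (-x) / (real n + 1)) * exp (-x) ^ n \<le> 1 * exp (-x) ^ n"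
          by (intro mult_right_mono) (auto simp: divide_le_eq_1)
        finally show "norm ((-1) ^ n * (1 / real (n + 1)) * (- exp (-x)) ^ Suc n) \<le> exp (-x) ^ n" by simp
      qed
      ultimately show ?thesis by (simp add: summable_sums)
    qed
    moreover have "- ((-1) ^ n * (1 / real (n + 1)) * (- exp (-x)) ^ Suc n) = exp (- (real n + 1) * x) / (real n + 1)" for n
    proof -
      have "(- exp (-x)) ^ Suc n = (-1) ^ Suc n * exp (- (real n + 1) * x)"
        using exp_of_nat_mult[of "Suc n" "-x"] by (subst power_minus) (simp add: algebra_simps)
      hence "- ((-1) ^ n * (1 / real (n + 1)) * (- exp (-x)) ^ Suc n)
         = (((-1) ^ n * (-1) ^ n)) * (exp (- (real n + 1) * x) / (real n + 1))"
        by (simp add: add.commute)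
      also have "(-1::real) ^ n * (-1) ^ n = 1" by (simp flip: power_mult_distrib)
      finally show ?thesis by simp
    qed
    ultimately show ?thesis using sums_minus by fastforce
  qed
  have "(\<integral>\<^sup>+x. ennreal (- ln (1 - exp (- x))) * indicator {0<..} x \<partial>lborel)
     = (\<integral>\<^sup>+x. (\<Sum>n. ?h n x) \<partial>lborel)"
  proof (rule nn_integral_cong_AE, rule AE_mp[OF AE_lborel_singleton[of 0]], intro AE_I2 impI)
    fix x :: real assume "x \<noteq> 0"
    show "ennreal (- ln (1 - exp (- x))) * indicator {0<..} x = (\<Sum>n. ?h n x)"
    proof (cases "x > 0")
      case True
      have "(\<Sum>n. ?h n x) = (\<Sum>n. ennreal (exp (- (real n + 1) * x) / (real n + 1)))"
        using True by (simp add: indicator_def)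
      also have "\<dots> = ennreal (\<Sum>n. exp (- (real n + 1) * x) / (real n + 1))"
        by (intro suminf_ennreal2 sums_summable[OF s[OF True]]) auto
      also have "\<dots> = ennreal (- ln (1 - exp (- x)))" using sums_unique[OF s[OF True]] by simp
      finally show ?thesis using True by simp
    qed (use \<open>x \<noteq> 0\<close> in \<open>auto simp: indicator_def\<close>)
  qed
  also have "\<dots> = (\<Sum>n. \<integral>\<^sup>+x. ?h n x \<partial>lborel)" by (rule nn_integral_suminf) auto
  also have "\<dots> = (\<Sum>n. ennreal (1 / (real n + 1)\<^sup>2))"
  proof (intro suminf_cong)
    fix n :: nat
    have "(\<integral>\<^sup>+x. ?h n x \<partial>lborel) = ennreal (0 - (- exp (- (real n + 1) * 0) / (real n + 1)\<^sup>2))"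
    proof (rule nn_integral_FTC_atLeast)
      have "((\<lambda>x. exp (- (real n + 1) * x)) \<longlongrightarrow> 0) at_top" by real_asymp
      from tendsto_divide[OF tendsto_minus[OF this] tendsto_const[of "(real n + 1)\<^sup>2"]]
      show "((\<lambda>x. - exp (- (real n + 1) * x) / (real n + 1)\<^sup>2) \<longlongrightarrow> 0) at_top"
        by (simp add: add_nonneg_eq_0_iff)
      have "real n + 1 > 0" by simp
      thus "((\<lambda>x. - exp (- (real n + 1) * x) / (real n + 1)\<^sup>2) has_real_derivative
         exp (- (real n + 1) * x) / (real n + 1)) (at x)" for x
          by (auto intro!: derivative_eq_intros simp: power2_eq_square divide_simps) (simp add: algebra_simps)
    qed auto
    thus "(\<integral>\<^sup>+x. ?h n x \<partial>lborel) = ennreal (1 / (real n + 1)\<^sup>2)" by simp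
  qed
  also have "\<dots> = ennreal (\<Sum>n. 1 / (real n + 1)\<^sup>2)"
    using inverse_squares_sums by (intro suminf_ennreal2) (auto simp: sums_iff add.commute)
  also have "(\<Sum>n. 1 / (real n + 1)\<^sup>2) = pi\<^sup>2 / 6"
    using inverse_squares_sums by (simp add: sums_iff add.commute)
  finally show ?thesis .
qed

text \<open>From \<open>ln (1 + y) = - ln (1 - y) + ln (1 - y\<^sup>2)\<close> and a rescaling by 2.\<close>

lemma nn_integral_ln_one_plus_exp:
  "(\<integral>\<^sup>+x. ennreal (ln (1 + exp (- x))) * indicator {0..} x \<partial>lborel) = ennreal (pi\<^sup>2 / 12)"
proof -
  let ?I = "\<integral>\<^sup>+x. ennreal (ln (1 + exp (- x))) * indicator {0..} x \<partial>lborel"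
  have "ennreal (pi\<^sup>2 / 6) = (\<integral>\<^sup>+x. ennreal (- ln (1 - exp (- x))) * indicator {0<..} x \<partial>lborel)"
    by (rule nn_integral_ln_one_minus_exp[symmetric])
  also have "\<dots> = (\<integral>\<^sup>+x. ennreal (ln (1 + exp (- x))) * indicator {0..} x
       + ennreal (- ln (1 - exp (- (2 * x)))) * indicator {0<..} (2 * x) \<partial>lborel)"
  proof (rule nn_integral_cong_AE, rule AE_mp[OF AE_lborel_singleton[of 0]], intro AE_I2 impI)
    fix x :: real assume "x \<noteq> 0"
    show "ennreal (- ln (1 - exp (- x))) * indicator {0<..} x = ennreal (ln (1 + exp (- x))) * indicator {0..} x
       + ennreal (- ln (1 - exp (- (2 * x)))) * indicator {0<..} (2 * x)"
    proof (cases "x > 0")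
      case True
      have e: "0 < exp (-x)" "exp (-x) < 1" using True by auto
      have "exp (- (2 * x)) = exp (-x) * exp (-x)" by (simp add: mult_exp_exp)
      hence "1 - exp (- (2 * x)) = (1 + exp (-x)) * (1 - exp (-x))" by (simp add: algebra_simps)
      hence "- ln (1 - exp (-x)) = ln (1 + exp (-x)) + (- ln (1 - exp (- (2 * x))))"
        using e add_pos_pos[OF zero_less_one e(1)] by (simp add: ln_mult_pos)
      hence "ennreal (- ln (1 - exp (-x))) = ennreal (ln (1 + exp (-x))) + ennreal (- ln (1 - exp (- (2 * x))))"
        using e True by (subst ennreal_plus[symmetric]) (auto intro!: ln_ge_zero)
      thus ?thesis using True by (simp add: indicator_def)
    qed (use \<open>x \<noteq> 0\<close> in \<open>auto simp: indicator_def\<close>)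
  qed
  also have "\<dots> = ?I + (\<integral>\<^sup>+x. ennreal (- ln (1 - exp (- (2 * x)))) * indicator {0<..} (2 * x) \<partial>lborel)"
    by (rule nn_integral_add) auto
  also have "(\<integral>\<^sup>+x. ennreal (- ln (1 - exp (- (2 * x)))) * indicator {0<..} (2 * x) \<partial>lborel) = ennreal (pi\<^sup>2 / 12)"
  proof -
    let ?J = "\<integral>\<^sup>+x. ennreal (- ln (1 - exp (- (2 * x)))) * indicator {0<..} (2 * x) \<partial>lborel"
    have "ennreal 2 * ?J = ennreal (pi\<^sup>2 / 6)"
      using nn_integral_real_affine[of "\<lambda>x. ennreal (- ln (1 - exp (- x))) * indicator {0<..} x" 2 0]
      by (simp add: nn_integral_ln_one_minus_exp)
    hence "ennreal (1/2) * (ennreal 2 * ?J) = ennreal (1/2) * ennreal (pi\<^sup>2 / 6)" by simp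
    thus ?thesis by (simp add: mult.assoc[symmetric] ennreal_mult'[symmetric] del: ennreal_half ennreal_numeral)
  qed
  finally have "ennreal (pi\<^sup>2 / 12 + pi\<^sup>2 / 12) = ?I + ennreal (pi\<^sup>2 / 12)" by simp
  hence "ennreal (pi\<^sup>2 / 12) + ennreal (pi\<^sup>2 / 12) = ennreal (pi\<^sup>2 / 12) + ?I"
    by (subst (asm) ennreal_plus) (auto simp: add.commute)
  thus ?thesis by (subst (asm) ennreal_add_left_cancel) auto
qed

lemma entropy_profile_integral:
  "(\<integral>\<^sup>+x. ennreal (ln (1 + exp (- \<bar>x\<bar>))) \<partial>lborel) \<le> ennreal (pi\<^sup>2 / 6)"
  using nn_integral_abs_le[of "\<lambda>x. ln (1 + exp (- x))" "pi\<^sup>2 / 12"]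
  by (simp add: nn_integral_ln_one_plus_exp)

section \<open>Dual profile for the kinetic energy estimate\<close>

text \<open>
  The harmonic mean over a horizontal section of the density profile that is optimal
  for the kinetic energy estimate, clamped to the interval from \<open>rm\<close> to \<open>rp\<close>.
\<close>

definition atwood_centre :: "real \<Rightarrow> real \<Rightarrow> real \<Rightarrow> real" where
  "atwood_centre rp rm x = sqrt (rp * rm * min (rp / rm) (max (rm / rp) (1 + x)))"

text \<open>With \<open>c\<close> the centre and \<open>y = c\<^sup>2 / (rp * rm)\<close>, this is
  \<open>(rp - c)\<^sup>2 / rp\<close> for \<open>x \<ge> 0\<close> and
  \<open>(rm - c)\<^sup>2 / rm\<close> for \<open>x < 0\<close>: the quantity to be bounded,
  evaluated at the reference density. It vanishes where the clamp makes \<open>c\<close> equal to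
  that density.\<close>

definition atwood_profile :: "real \<Rightarrow> real \<Rightarrow> real \<Rightarrow> real" where
  "atwood_profile rp rm x = (let y = min (rp / rm) (max (rm / rp) (1 + x)) in
     if x \<ge> 0 then rp + y * rm - 2 * sqrt (rp * rm * y) else rm + y * rp - 2 * sqrt (rp * rm * y))"

text \<open>The left side expands to \<open>r - 2 * c + y * (rp * rm / r)\<close>. Replacing
  \<open>1 / r\<close> by its chord makes this affine in \<open>r\<close> with slope
  \<open>1 - y\<close>, and \<open>y = 1 + x\<close> is the choice for which the slope equals
  \<open>- x\<close>, that of the potential term. Where the clamp is active, the mismatch of the
  slopes has the favourable sign.\<close>

lemma atwood_le_profile:
  fixes rp rm r x :: real
  assumes "0 < rm" "rm < rp" "rm \<le> r" "r \<le> rp"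
  shows "(r - atwood_centre rp rm x)\<^sup>2 / r \<le> x * ((if x \<ge> 0 then rp else rm) - r) + atwood_profile rp rm x"
proof -
  define y where "y = min (rp / rm) (max (rm / rp) (1 + x))"
  define c where "c = atwood_centre rp rm x"
  have rmp: "rm / rp \<le> 1" "1 \<le> rp / rm" using assms by (auto simp: divide_le_eq_1 le_divide_eq_1)
  have ypos: "y > 0" using assms unfolding y_def by (auto simp: less_max_iff_disj)
  have c: "c = sqrt (rp * rm * y)" unfolding c_def atwood_centre_def y_def ..
  have csq: "c\<^sup>2 = rp * rm * y" using c ypos assms by simp
  have "(r - c)\<^sup>2 / r = r - 2 * c + y * (rp * rm / r)"
    using assms csq by (simp add: power2_diff field_simps) (simp add: power2_eq_square)
  \<comment> \<open>convexity: the chord of \<open>1 / r\<close> over the interval from \<open>rm\<close> to \<open>rp\<close>\<close>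
  also have "rp * rm / r \<le> rp + rm - r"
  proof -
    have "0 \<le> (rp - r) * (r - rm)" using assms by simp
    hence "rp * rm \<le> (rp + rm - r) * r" by (simp add: algebra_simps)
    thus ?thesis using assms by (simp add: divide_le_eq)
  qed
  hence "r - 2 * c + y * (rp * rm / r) \<le> r - 2 * c + y * (rp + rm - r)"
    using ypos by (intro add_left_mono mult_left_mono) auto
  also have "\<dots> \<le> x * ((if x \<ge> 0 then rp else rm) - r) + atwood_profile rp rm x"
  proof (cases "x \<ge> 0")
    case True
    have "y - 1 \<le> x" using True rmp unfolding y_def by auto
    hence "(y - 1) * (rp - r) \<le> x * (rp - r)" using assms by (intro mult_right_mono) auto
    thus ?thesis using True
      by (simp add: atwood_profile_def Let_def flip: y_def c) (simp add: algebra_simps)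
  next
    case False
    have "1 - y \<le> - x" using False rmp unfolding y_def by auto
    hence "(1 - y) * (r - rm) \<le> - x * (r - rm)" using assms by (intro mult_right_mono) auto
    thus ?thesis using False
      by (simp add: atwood_profile_def Let_def flip: y_def c) (simp add: algebra_simps)
  qed
  finally show ?thesis unfolding c_def .
qed

lemma continuous_on_atwood_centre:
  "0 < rm \<Longrightarrow> rm < rp \<Longrightarrow> continuous_on S (atwood_centre rp rm)"
  unfolding atwood_centre_def by (intro continuous_intros)

lemma borel_measurable_atwood_profile [measurable]:
  "atwood_profile rp rm \<in> borel_measurable borel"
  unfolding atwood_profile_def Let_def by measurable

text \<open>With \<open>p = sqrt rp\<close> and \<open>q = sqrt rm\<close> the profile is
  \<open>(p - q * sqrt (1 + x))\<^sup>2\<close> on \<open>{0..?a}\<close>,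
  \<open>(q - p * sqrt (1 + x))\<^sup>2\<close> on \<open>{- ?b..<0}\<close>, and 0 elsewhere. The
  primitives contain \<open>(1 + x) * sqrt (1 + x)\<close>; their contributions at
  \<open>x = 0\<close>, multiples of \<open>p * q\<close>, cancel between the two sides, so the
  result is rational in \<open>rp\<close> and \<open>rm\<close>.\<close>

lemma atwood_profile_integral:
  fixes rp rm :: real
  assumes "0 < rm" "rm < rp"
  shows "(\<integral>\<^sup>+x. ennreal (atwood_profile rp rm x) \<partial>lborel) \<le> ennreal ((rp - rm) ^ 3 / (6 * rp * rm))"
proof -
  define p q where "p = sqrt rp" and "q = sqrt rm"
  have pq: "0 < q" "q < p" using assms by (auto simp: p_def q_def)
  have rp: "rp = p\<^sup>2" and rm: "rm = q\<^sup>2" using assms by (auto simp: p_def q_def)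
  have sq: "sqrt (rp * rm * y) = p * q * sqrt y" if "y \<ge> 0" for y
    using pq by (simp add: rp rm real_sqrt_mult)
  have nn: "a\<^sup>2 + y * b\<^sup>2 - 2 * (a * b) * sqrt y = (a - b * sqrt y)\<^sup>2" if "y \<ge> 0" for a b y :: real
    using that by (simp add: power2_diff power_mult_distrib)
  define G where "G = (\<lambda>x. (1 + x) * sqrt (1 + x :: real))"
  have dG: "(G has_real_derivative (3 / 2 * sqrt (1 + x))) (at x)" if "x > -1" for x
    unfolding G_def using that by (auto intro!: derivative_eq_intros simp: field_simps real_sqrt_pow2_iff)
  let ?a = "p\<^sup>2 / q\<^sup>2 - 1" and ?b = "1 - q\<^sup>2 / p\<^sup>2"
  let ?f = "\<lambda>x. p\<^sup>2 + (1 + x) * q\<^sup>2 - 2 * (p * q) * sqrt (1 + x)"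
  let ?h = "\<lambda>x. q\<^sup>2 + (1 + x) * p\<^sup>2 - 2 * (p * q) * sqrt (1 + x)"
  let ?F = "\<lambda>x. p\<^sup>2 * x + (x + x\<^sup>2 / 2) * q\<^sup>2 - 4 / 3 * (p * q) * G x"
  let ?H = "\<lambda>x. q\<^sup>2 * x + (x + x\<^sup>2 / 2) * p\<^sup>2 - 4 / 3 * (p * q) * G x"
  have dF: "(?F has_real_derivative ?f x) (at x)" if "x > -1" for x
    by (auto intro!: derivative_eq_intros dG that simp: field_simps)
  have dH: "(?H has_real_derivative ?h x) (at x)" if "x > -1" for x
    by (auto intro!: derivative_eq_intros dG that simp: field_simps)
  have ab: "0 \<le> ?a" "0 \<le> ?b" "?b < 1" using pq by (auto simp: field_simps power_mono)
  have "(\<integral>\<^sup>+x. ennreal (atwood_profile rp rm x) \<partial>lborel)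
     \<le> (\<integral>\<^sup>+x. ennreal (?f x) * indicator {0..?a} x + ennreal (?h x) * indicator {- ?b..0} x \<partial>lborel)"
  proof (rule nn_integral_mono)
    fix x :: real
    define y where "y = min (rp / rm) (max (rm / rp) (1 + x))"
    consider "x > ?a" | "0 \<le> x" "x \<le> ?a" | "x < 0" "x \<ge> - ?b" | "x < - ?b" using ab by linarith
    thus "ennreal (atwood_profile rp rm x)
      \<le> ennreal (?f x) * indicator {0..?a} x + ennreal (?h x) * indicator {- ?b..0} x"
    proof cases
      case 1
      hence "x \<ge> 0" and y: "y = p\<^sup>2 / q\<^sup>2" using ab unfolding y_def rp rm by (auto simp: min_def max_def)
      hence "atwood_profile rp rm x = p\<^sup>2 + y * q\<^sup>2 - 2 * (p * q) * sqrt y"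
        unfolding atwood_profile_def Let_def y_def[symmetric] using sq[of y] by (simp add: rp rm)
      also have "\<dots> = 0" using pq unfolding y by (simp add: real_sqrt_divide power2_eq_square)
      finally show ?thesis by simp
    next
      case 2
      hence y: "y = 1 + x" using ab unfolding y_def rp rm by (auto simp: min_def max_def)
      hence "atwood_profile rp rm x = ?f x"
        using 2 unfolding atwood_profile_def Let_def y_def[symmetric] y using sq[of y] by (simp add: rp rm y)
      thus ?thesis using 2 by (simp add: indicator_def)
    next
      case 3
      hence y: "y = 1 + x" using ab unfolding y_def rp rm by (auto simp: min_def max_def)
      hence "atwood_profile rp rm x = ?h x"
        using 3 ab unfolding atwood_profile_def Let_def y_def[symmetric] y using sq[of y] by (simp add: rp rm y)
      thus ?thesis using 3 by (simp add: indicator_def)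
    next
      case 4
      hence x: "x < 0" and y: "y = q\<^sup>2 / p\<^sup>2" using ab unfolding y_def rp rm by (auto simp: min_def max_def)
      hence "atwood_profile rp rm x = q\<^sup>2 + y * p\<^sup>2 - 2 * (p * q) * sqrt y"
        unfolding atwood_profile_def Let_def y_def[symmetric] using sq[of y] by (simp add: rp rm)
      also have "\<dots> = 0" using pq unfolding y by (simp add: real_sqrt_divide power2_eq_square)
      finally show ?thesis by simp
    qed
  qed
  also have "\<dots> = (\<integral>\<^sup>+x. ennreal (?f x) * indicator {0..?a} x \<partial>lborel)
      + (\<integral>\<^sup>+x. ennreal (?h x) * indicator {- ?b..0} x \<partial>lborel)"
    by (rule nn_integral_add) auto
  also have "(\<integral>\<^sup>+x. ennreal (?f x) * indicator {0..?a} x \<partial>lborel) = ennreal (?F ?a - ?F 0)"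
  proof (rule nn_integral_FTC_Icc)
    fix x assume x: "x \<in> {0..?a}"
    show "(?F has_real_derivative ?f x) (at x)" using x by (intro dF) auto
    show "0 \<le> ?f x" using x nn[of "1 + x" p q] by simp
  qed (use ab in auto)
  also have "(\<integral>\<^sup>+x. ennreal (?h x) * indicator {- ?b..0} x \<partial>lborel) = ennreal (?H 0 - ?H (- ?b))"
  proof (rule nn_integral_FTC_Icc)
    fix x assume x: "x \<in> {- ?b..0}"
    hence "x > -1" using ab by auto
    thus "(?H has_real_derivative ?h x) (at x)" by (rule dH)
    show "0 \<le> ?h x" using \<open>x > -1\<close> nn[of "1 + x" q p] by (simp add: mult.commute mult.left_commute)
  qed (use ab in auto)
  also have "ennreal (?F ?a - ?F 0) + ennreal (?H 0 - ?H (- ?b)) = ennreal ((rp - rm) ^ 3 / (6 * rp * rm))"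
  proof -
    have F: "?F 0 \<le> ?F ?a"
    proof (rule DERIV_nonneg_imp_nondecreasing[OF ab(1)], intro exI conjI)
      fix x :: real assume "0 \<le> x"
      thus "(?F has_real_derivative ?f x) (at x)" "0 \<le> ?f x" using nn[of "1 + x" p q] dF[of x] by auto
    qed
    have H: "?H (- ?b) \<le> ?H 0"
    proof (rule DERIV_nonneg_imp_nondecreasing, use ab in simp, intro exI conjI)
      fix x :: real assume "- ?b \<le> x"
      hence "x > -1" using ab by simp
      thus "(?H has_real_derivative ?h x) (at x)" "0 \<le> ?h x"
        using nn[of "1 + x" q p] dH[of x] by (auto simp: mult.commute mult.left_commute)
    qed
    have s: "sqrt (1 + ?a) = p / q" "sqrt (1 + - ?b) = q / p" using pq by (auto simp: real_sqrt_divide)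
    have "?F ?a - ?F 0 + (?H 0 - ?H (- ?b)) = (p\<^sup>2 - q\<^sup>2) ^ 3 / (6 * p\<^sup>2 * q\<^sup>2)"
      unfolding G_def s using pq by (simp add: field_simps) algebra
    thus ?thesis using F H unfolding rp rm by (subst ennreal_plus[symmetric]) (auto simp del: ennreal_plus)
  qed
  finally show ?thesis .
qed

section \<open>Differential inequality for the energy\<close>

text \<open>The derivative of \<open>F powr (1/4)\<close> is at most
  \<open>k + F t powr (-3/4) / 4\<close>. Since \<open>F t \<ge> t\<close>, the second term is at
  most the derivative of \<open>t powr (1/4)\<close>, so the inhomogeneous 1 costs only a lower
  order correction to the linear growth \<open>k * t\<close>.\<close>

lemma quarter_power_growth:
  fixes F F' :: "real \<Rightarrow> real" and k t :: real
  assumes cont: "continuous_on {0..} F"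
    and deriv: "\<And>t. t > 0 \<Longrightarrow> (F has_real_derivative F' t) (at t)"
    and lower: "\<And>t. t \<ge> 0 \<Longrightarrow> F t \<ge> 1 + t"
    and upper: "\<And>t. t > 0 \<Longrightarrow> F' t \<le> 1 + 4 * k * F t powr (3/4)"
    and "t \<ge> 0"
  shows "F t \<le> (k * t + t powr (1/4) + F 0 powr (1/4)) ^ 4"
proof -
  define G where "G t = F t powr (1/4) - k * t - t powr (1/4)" for t
  have "G t \<le> G 0"
  proof (rule DERIV_nonpos_imp_decreasing_open[OF \<open>t \<ge> 0\<close>])
    have c1: "continuous_on {0..t} (\<lambda>t. F t powr (1/4))"
    proof (rule continuous_on_powr')
      show "\<forall>x\<in>{0..t}. 0 \<le> F x \<and> (F x = 0 \<longrightarrow> 0 < 1/4)"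
      proof
        fix x assume "x \<in> {0..t}"
        hence "F x \<ge> 1 + x" "x \<ge> 0" using lower[of x] by auto
        thus "0 \<le> F x \<and> (F x = 0 \<longrightarrow> 0 < 1/4)" by simp
      qed
    qed (auto intro: continuous_on_subset[OF cont])
    have c2: "continuous_on {0..t} (\<lambda>t. t powr (1/4))"
      by (rule continuous_on_powr') auto
    show "continuous_on {0..t} G"
      unfolding G_def
      by (intro continuous_on_diff c1 c2 continuous_on_mult continuous_on_const continuous_on_id)
    fix s assume s: "0 < s" "s < t"
    hence Fs: "F s > 0" "s \<le> F s" using lower[of s] by auto
    have "(G has_real_derivative (1/4) * F s powr (1/4 - 1) * F' s - k - (1/4) * s powr (1/4 - 1)) (at s)"
      unfolding G_def using s Fs deriv[OF s(1)]
      by (auto intro!: derivative_eq_intros simp: powr_diff)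
    moreover have "(1/4) * F s powr (1/4 - 1) * F' s - k - (1/4) * s powr (1/4 - 1) \<le> 0"
    proof -
      have "F s powr (1/4 - 1) * F' s \<le> F s powr (1/4 - 1) * (1 + 4 * k * F s powr (3/4))"
        by (intro mult_left_mono upper s) auto
      also have "\<dots> = F s powr (1/4 - 1) + 4 * k * (F s powr (1/4 - 1) * F s powr (3/4))"
        by (simp add: algebra_simps)
      also have "F s powr (1/4 - 1) * F s powr (3/4) = 1" using Fs by (simp flip: powr_add)
      also have "F s powr (1/4 - 1) \<le> s powr (1/4 - 1)"
        using Fs s by (intro powr_mono2') auto
      finally show ?thesis by simp
    qed
    ultimately show "\<exists>y. (G has_real_derivative y) (at s) \<and> y \<le> 0" by blast
  qed
  hence "F t powr (1/4) \<le> k * t + t powr (1/4) + F 0 powr (1/4)" by (simp add: G_def)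
  hence "(F t powr (1/4)) ^ 4 \<le> (k * t + t powr (1/4) + F 0 powr (1/4)) ^ 4"
    by (intro power_mono) auto
  moreover have "(F t powr (1/4)) ^ 4 = F t" using lower[OF \<open>t \<ge> 0\<close>] \<open>t \<ge> 0\<close> by (simp add: powr_power)
  ultimately show ?thesis by simp
qed

text \<open>Minimizing over \<open>m\<close> gives \<open>m = sqrt (K / F)\<close> and turns the
  bracket into \<open>2 * sqrt (K * F)\<close>. Then \<open>a = (K / F) powr (1/4) / sqrt g\<close>
  balances the two remaining terms, with total
  \<open>2 * sqrt g * K powr (1/4) * F powr (3/4)\<close>; the condition on \<open>k\<close> names
  this constant. In terms of the fourth roots these minimizers are
  \<open>b\<^sup>2 / s\<^sup>2\<close> and \<open>b / (h * s)\<close>.\<close>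

lemma optimized_growth_rate:
  fixes d F g K k :: real
  assumes bound: "\<And>a m. a > 0 \<Longrightarrow> m > 0 \<Longrightarrow> d \<le> a * g * F + (m * F + K / m) / (2 * a)"
    and pos: "F > 0" "g > 0" "K > 0" "k \<ge> 0" and k: "k ^ 4 = g\<^sup>2 * K / 16"
  shows "d \<le> 4 * k * F powr (3/4)"
proof -
  define s b h where "s = F powr (1/4)" and "b = K powr (1/4)" and "h = sqrt g"
  have sbh: "s > 0" "b > 0" "h > 0" using pos by (auto simp: s_def b_def h_def)
  have F: "F = s ^ 4" and K: "K = b ^ 4" and g: "g = h\<^sup>2"
    using pos by (auto simp: s_def b_def h_def powr_power)
  have "k ^ 4 = (h * b / 2) ^ 4" unfolding k g K by (simp add: power_divide power_mult_distrib)
  hence kk: "k = h * b / 2"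
    using pos sbh by (metis divide_nonneg_pos mult_pos_pos less_imp_le power_eq_imp_eq_base zero_less_numeral)
  have "d \<le> b / (h * s) * g * F + (b\<^sup>2 / s\<^sup>2 * F + K / (b\<^sup>2 / s\<^sup>2)) / (2 * (b / (h * s)))"
    using sbh by (intro bound) auto
  also have "b / (h * s) * g * F = b * h * s ^ 3"
    unfolding F g using sbh by (simp add: field_simps power2_eq_square power3_eq_cube power4_eq_xxxx)
  also have "b\<^sup>2 / s\<^sup>2 * F + K / (b\<^sup>2 / s\<^sup>2) = 2 * (b\<^sup>2 * s\<^sup>2)"
    unfolding F K using sbh by (simp add: field_simps power2_eq_square power4_eq_xxxx)
  also have "2 * (b\<^sup>2 * s\<^sup>2) / (2 * (b / (h * s))) = b * h * s ^ 3"
    using sbh by (simp add: field_simps power2_eq_square power3_eq_cube)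
  also have "b * h * s ^ 3 + b * h * s ^ 3 = 4 * k * s ^ 3"
    unfolding kk by simp
  also have "s ^ 3 = F powr (3/4)" using pos unfolding s_def by (simp add: powr_power)
  finally show ?thesis .
qed

text \<open>The choice \<open>l = sqrt (K / G)\<close> makes \<open>l * G\<close> and
  \<open>K / l\<close> equal. Taking \<open>l\<close> from the bound \<open>G\<close> and not from
  \<open>e\<close> admits any sign of \<open>e\<close>.\<close>

lemma optimized_profile_bound:
  fixes H e G K :: real
  assumes bound: "\<And>l. l > 0 \<Longrightarrow> H \<le> l * e + K / l" and "e \<le> G" "G > 0" "K > 0"
  shows "H \<le> 2 * sqrt (K * G)"
proof -
  define a b where "a = sqrt K" and "b = sqrt G"
  have ab: "a > 0" "b > 0" and K: "K = a\<^sup>2" and G: "G = b\<^sup>2" using assms by (auto simp: a_def b_def)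
  have "H \<le> a / b * e + K / (a / b)" using ab by (intro bound) auto
  also have "\<dots> \<le> a / b * G + K / (a / b)" using ab \<open>e \<le> G\<close> by (intro add_right_mono mult_left_mono) auto
  also have "\<dots> = 2 * (a * b)" using ab unfolding K G by (simp add: field_simps power2_eq_square)
  also have "a * b = sqrt (K * G)" by (simp add: a_def b_def real_sqrt_mult)
  finally show ?thesis by simp
qed

text \<open>Recovers a Cauchy-Schwarz bound from its linearizations. The weight
  \<open>b = h / P\<close> turns the second summand into \<open>P\<close>; it is not admissible for
  \<open>h = 0\<close>, where the small weight \<open>P / (s + 1)\<close> contradicts
  \<open>P > 0\<close>.\<close>

lemma square_le_prod_if_AM_GM:
  fixes P s h :: real
  assumes bound: "\<And>b. b > 0 \<Longrightarrow> P \<le> (b * s + h / b) / 2" and "P \<ge> 0" "s \<ge> 0" "h \<ge> 0"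
  shows "P\<^sup>2 \<le> s * h"
proof (cases "P = 0")
  case False
  hence P: "P > 0" using assms by simp
  show ?thesis
  proof (cases "h = 0")
    case True
    have "P \<le> (P / (s + 1) * s) / 2" using bound[of "P / (s + 1)"] True P \<open>s \<ge> 0\<close> by simp
    also have "\<dots> = P * (s / (2 * (s + 1)))" by simp
    also have "\<dots> < P * 1" using P \<open>s \<ge> 0\<close> by (intro mult_strict_left_mono) (auto simp: field_simps)
    finally show ?thesis by simp
  next
    case False
    have "P \<le> (h / P * s + h / (h / P)) / 2" using False assms P by (intro bound) auto
    hence "P \<le> h / P * s" using False by simp
    thus ?thesis using P by (simp add: field_simps power2_eq_square)
  qed
qed (use assms in auto)

section \<open>Integration by parts on periodic slabs\<close>

text \<open>The box extended by \<open>s\<close> in direction \<open>k\<close> is cut twice: at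
  height \<open>a \<bullet> k + s\<close> into a layer of thickness \<open>s\<close> and the shifted
  box, and at \<open>b \<bullet> k\<close> into the original box and another such layer. The two
  layers differ by a translation by one period.\<close>

lemma integral_periodic_shift:
  fixes f :: "'a::euclidean_space \<Rightarrow> real"
  assumes cont: "continuous_on UNIV f" and k: "k \<in> Basis" and l: "b \<bullet> k = a \<bullet> k + l" "l > 0"
    and per: "\<And>x. f (x + l *\<^sub>R k) = f x" and s: "0 \<le> s"
  shows "integral (cbox a b) (\<lambda>x. f (x + s *\<^sub>R k)) = integral (cbox a b) f"
proof -
  let ?B = "cbox a (b + s *\<^sub>R k)"
  have int: "f integrable_on ?B"
    by (intro integrable_continuous continuous_on_subset[OF cont]) auto
  have sets: "?B \<inter> {x. x \<bullet> k \<ge> a \<bullet> k + s} = cbox (a + s *\<^sub>R k) (b + s *\<^sub>R k)"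
    "?B \<inter> {x. x \<bullet> k \<le> a \<bullet> k + s} = cbox a (b + (s - l) *\<^sub>R k)"
    "?B \<inter> {x. x \<bullet> k \<le> b \<bullet> k} = cbox a b"
    "?B \<inter> {x. x \<bullet> k \<ge> b \<bullet> k} = cbox (a + l *\<^sub>R k) (b + (s - l) *\<^sub>R k + l *\<^sub>R k)"
    using k l s
    by (auto simp: mem_box inner_add_left inner_diff_left inner_Basis algebra_simps
        split: if_splits) (smt (verit))+
  have "integral (cbox a b) (\<lambda>x. f (x + s *\<^sub>R k)) = integral (cbox (a + s *\<^sub>R k) (b + s *\<^sub>R k)) f"
    using integral_shift_cbox_plus[of a b f "s *\<^sub>R k"] by (simp add: o_def add.commute)
  moreover have "integral (cbox a (b + (s - l) *\<^sub>R k)) f = integral (cbox (a + l *\<^sub>R k) (b + (s - l) *\<^sub>R k + l *\<^sub>R k)) f"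
    using integral_shift_cbox_plus[of a "b + (s - l) *\<^sub>R k" f "l *\<^sub>R k"] per by (simp add: o_def add.commute)
  ultimately show ?thesis
    using integral_split[OF int k, of "a \<bullet> k + s"] integral_split[OF int k, of "b \<bullet> k"]
    unfolding sets by simp
qed

text \<open>By periodicity the integral of \<open>f (x + s *\<^sub>R k)\<close> does not depend on
  \<open>s\<close>, and differentiating under the integral sign produces the integral of the
  derivative. No horizontal coordinate has to be split off by Fubini.\<close>

lemma integral_periodic_derivative:
  fixes f :: "'a::euclidean_space \<Rightarrow> real"
  assumes der: "\<And>x. (f has_derivative f' x) (at x)" and cont: "continuous_on UNIV (\<lambda>x. f' x k)"
    and k: "k \<in> Basis" and l: "b \<bullet> k = a \<bullet> k + l" "l > 0"
    and per: "\<And>x. f (x + l *\<^sub>R k) = f x"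
  shows "integral (cbox a b) (\<lambda>x. f' x k) = 0"
proof -
  \<comment> \<open>The shift lemma covers only \<open>s \<ge> 0\<close>. Moving the box back by
    \<open>k\<close> makes the original box correspond to the interior point \<open>s = 1\<close>,
    where a two-sided derivative exists.\<close>
  let ?a = "a - k" and ?b = "b - k"
  have contf: "continuous_on UNIV f"
    using der by (intro continuous_at_imp_continuous_on) (auto intro: has_derivative_continuous)
  have "((\<lambda>s. integral (cbox ?a ?b) (\<lambda>x. f (x + s *\<^sub>R k))) has_field_derivative
      integral (cbox ?a ?b) (\<lambda>x. f' (x + 1 *\<^sub>R k) k)) (at 1 within {0..2})"
  proof (rule leibniz_rule_field_derivative)
    fix s :: real and x :: 'a
    have "((\<lambda>s. f (x + s *\<^sub>R k)) has_derivative (\<lambda>h. f' (x + s *\<^sub>R k) (h *\<^sub>R k))) (at s within {0..2})"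
      by (rule has_derivative_compose[OF _ der]) (auto intro!: derivative_eq_intros)
    moreover have "(\<lambda>h. f' (x + s *\<^sub>R k) (h *\<^sub>R k)) = (\<lambda>h. h * f' (x + s *\<^sub>R k) k)"
      using linear_cmul[OF has_derivative_linear[OF der]] by fastforce
    ultimately show "((\<lambda>s. f (x + s *\<^sub>R k)) has_field_derivative f' (x + s *\<^sub>R k) k) (at s within {0..2})"
      by (simp add: has_field_derivative_def mult.commute[of _ "f' (x + s *\<^sub>R k) k"] mult_commute_abs)
  next
    fix s :: real
    show "(\<lambda>x. f (x + s *\<^sub>R k)) integrable_on cbox ?a ?b"
      by (intro integrable_continuous continuous_on_compose2[OF contf] continuous_intros) auto
  next
    show "continuous_on ({0..2} \<times> cbox ?a ?b) (\<lambda>(s, x). f' (x + s *\<^sub>R k) k)"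
      unfolding case_prod_beta
      by (intro continuous_on_compose2[OF cont] continuous_intros) auto
  qed auto
  hence "((\<lambda>s. integral (cbox ?a ?b) (\<lambda>x. f (x + s *\<^sub>R k))) has_real_derivative
      integral (cbox ?a ?b) (\<lambda>x. f' (x + k) k)) (at 1)"
    by (simp add: at_within_Icc_at)
  moreover have "((\<lambda>s. integral (cbox ?a ?b) (\<lambda>x. f (x + s *\<^sub>R k))) has_real_derivative 0) (at 1)"
  proof (rule has_field_derivative_transform_within_open[where S = "{0<..}"])
    show "((\<lambda>s. integral (cbox ?a ?b) f) has_real_derivative 0) (at 1)" by simp
    fix s :: real assume "s \<in> {0<..}"
    thus "integral (cbox ?a ?b) f = integral (cbox ?a ?b) (\<lambda>x. f (x + s *\<^sub>R k))"
      using l k by (intro integral_periodic_shift[OF contf k _ l(2) per, symmetric]) (auto simp: inner_diff_left)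
  qed auto
  ultimately have "integral (cbox ?a ?b) (\<lambda>x. f' (x + k) k) = 0" by (rule DERIV_unique)
  thus ?thesis using integral_shift_cbox[of a k b "\<lambda>x. f' x k"] by simp
qed

lemma integral_vertical_derivative:
  fixes f :: "'a::euclidean_space \<times> real \<Rightarrow> real"
  assumes der: "\<And>x. (f has_derivative f' x) (at x)" and cont: "continuous_on UNIV (\<lambda>x. f' x (0, 1))"
    and "c \<le> d"
  shows "integral (cbox (a, c) (b, d)) (\<lambda>x. f' x (0, 1))
      = integral (cbox a b) (\<lambda>y. f (y, d)) - integral (cbox a b) (\<lambda>y. f (y, c))"
proof -
  have contf: "continuous_on UNIV f"
    using der by (intro continuous_at_imp_continuous_on) (auto intro: has_derivative_continuous)
  have "integral (cbox (a, c) (b, d)) (\<lambda>x. f' x (0, 1))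
      = integral (cbox a b) (\<lambda>y. integral (cbox c d) (\<lambda>z. f' (y, z) (0, 1)))"
    by (intro integral_prod_continuous continuous_on_subset[OF cont]) auto
  also have "\<dots> = integral (cbox a b) (\<lambda>y. f (y, d) - f (y, c))"
  proof (intro integral_cong integral_unique)
    fix y
    show "((\<lambda>z. f' (y, z) (0, 1)) has_integral f (y, d) - f (y, c)) (cbox c d)"
      unfolding cbox_interval
    proof (rule fundamental_theorem_of_calculus[OF \<open>c \<le> d\<close>])
      fix z :: real
      have "((\<lambda>z. f (y, z)) has_derivative (\<lambda>h. f' (y, z) (0, h))) (at z within {c..d})"
        by (rule has_derivative_compose[OF _ der]) (auto intro!: derivative_eq_intros)
      moreover have "(\<lambda>h. f' (y, z) (0, h)) = (\<lambda>h. h *\<^sub>R f' (y, z) (0, 1))"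
      proof
        fix h show "f' (y, z) (0, h) = h *\<^sub>R f' (y, z) (0, 1)"
          using linear_cmul[OF has_derivative_linear[OF der], of "(y, z)" h "(0, 1)"] by simp
      qed
      ultimately show "((\<lambda>z. f (y, z)) has_vector_derivative f' (y, z) (0, 1)) (at z within {c..d})"
        by (simp add: has_vector_derivative_def)
    qed
  qed
  also have "\<dots> = integral (cbox a b) (\<lambda>y. f (y, d)) - integral (cbox a b) (\<lambda>y. f (y, c))"
    by (intro integral_diff integrable_continuous continuous_on_compose2[OF contf] continuous_intros) auto
  finally show ?thesis .
qed

text \<open>A box rather than a product of sets, so that the integration lemmas for boxes apply
  directly.\<close>

definition slab :: "real \<Rightarrow> real \<Rightarrow> real \<Rightarrow> 'n::finite point set" where
  "slab L c d = cbox (0, c) ((\<chi> i. L), d)"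

text \<open>The integrand is the divergence of \<open>a x *\<^sub>R v x\<close>. Its horizontal
  parts integrate to 0 by periodicity, and its vertical part leaves the fluxes through the top and
  the bottom. The evolution laws below are combinations of instances.\<close>

lemma slab_by_parts:
  fixes a :: "'n::finite point \<Rightarrow> real" and v :: "'n point \<Rightarrow> 'n point"
  assumes a: "\<And>x. (a has_derivative a' x) (at x)"
    and a': "\<And>b. b \<in> Basis \<Longrightarrow> continuous_on UNIV (\<lambda>x. a' x b)"
    and v: "\<And>x. (v has_derivative v' x) (at x)"
    and v': "\<And>b. b \<in> Basis \<Longrightarrow> continuous_on UNIV (\<lambda>x. v' x b)"
    and per: "y_periodic L a" "y_periodic L v" and "L > 0" "c \<le> d"
  shows "integral (slab L c d) (\<lambda>x. a x * (\<Sum>b\<in>Basis. v' x b \<bullet> b) + a' x (v x))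
    = integral (cell L) (\<lambda>y. a (y, d) * snd (v (y, d))) - integral (cell L) (\<lambda>y. a (y, c) * snd (v (y, c)))"
proof -
  define p where "p b x = a x * (v x \<bullet> b)" for b x
  define p' where "p' b x h = a x * (v' x h \<bullet> b) + a' x h * (v x \<bullet> b)" for b x h
  have p: "(p b has_derivative p' b x) (at x)" for b x
    unfolding p_def p'_def by (auto intro!: derivative_eq_intros a v)
  have conta: "continuous_on UNIV a" and contv: "continuous_on UNIV v"
    by (auto intro!: continuous_at_imp_continuous_on has_derivative_continuous[OF a] has_derivative_continuous[OF v])
  have cont: "continuous_on UNIV (\<lambda>x. p' b x b)" if "b \<in> Basis" for b
    unfolding p'_def using that by (intro continuous_intros conta contv a' v')
  have "a x * (\<Sum>b\<in>Basis. v' x b \<bullet> b) + a' x (v x) = (\<Sum>b\<in>Basis. p' b x b)" for x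
  proof -
    have "a' x (v x) = a' x (\<Sum>b\<in>Basis. (v x \<bullet> b) *\<^sub>R b)" by (simp add: euclidean_representation)
    also have "\<dots> = (\<Sum>b\<in>Basis. a' x b * (v x \<bullet> b))"
      using has_derivative_linear[OF a, of x] by (simp add: linear_sum linear_cmul mult.commute)
    finally show ?thesis by (simp add: p'_def sum.distrib sum_distrib_left)
  qed
  hence "integral (slab L c d) (\<lambda>x. a x * (\<Sum>b\<in>Basis. v' x b \<bullet> b) + a' x (v x))
      = (\<Sum>b\<in>Basis. integral (slab L c d) (\<lambda>x. p' b x b))"
    unfolding slab_def
    by (simp add: integral_sum integrable_continuous continuous_on_subset[OF cont])
  also have "\<dots> = integral (slab L c d) (\<lambda>x. p' (0, 1) x (0, 1))"
  proof -
    have "integral (slab L c d) (\<lambda>x. p' (e, 0) x (e, 0)) = 0" if e: "e \<in> Basis" for e :: "real ^ 'n"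
    proof -
      from e obtain i where i: "e = axis i 1" by (auto simp: Basis_vec_def)
      have "p (e, 0) (x + L *\<^sub>R (e, 0)) = p (e, 0) x" for x
      proof -
        have "x + L *\<^sub>R (e, 0) = (fst x + axis i L, snd x)"
          by (cases x) (simp add: i vec_eq_iff axis_def)
        thus ?thesis using per unfolding p_def y_periodic_def by simp
      qed
      moreover have "((\<chi> i. L), d) \<bullet> (e, 0) = (0, c) \<bullet> (e, 0) + L"
        by (simp add: i inner_axis)
      ultimately show ?thesis
        unfolding slab_def using \<open>L > 0\<close> e
        by (intro integral_periodic_derivative[OF p cont]) (auto simp: Basis_prod_def)
    qed
    thus ?thesis
      unfolding Basis_prod_def
      by (subst sum.union_disjoint) (auto simp: sum.reindex inj_on_def)
  qed
  also have "\<dots> = integral (cell L) (\<lambda>y. p (0, 1) (y, d)) - integral (cell L) (\<lambda>y. p (0, 1) (y, c))"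
    unfolding slab_def cell_def
    by (intro integral_vertical_derivative[OF p cont \<open>c \<le> d\<close>]) (auto simp: Basis_prod_def)
  finally show ?thesis by (simp add: p_def inner_prod_def)
qed

section \<open>Integrals over the strip\<close>

lemma slab_eq: "slab L c d = cell L \<times> {c..d}"
  by (simp add: slab_def cell_def cbox_Pair_eq)

lemma slab_subset_strip: "slab L c d \<subseteq> strip L"
  by (auto simp: slab_eq strip_def)

lemma strip_eq_UN_slab: "strip L = (\<Union>n. slab L (- real n) (real n))"
proof -
  have "\<exists>n. - real n \<le> z \<and> z \<le> real n" for z :: real
    by (metis abs_le_iff minus_le_iff real_arch_simple)
  thus ?thesis by (auto simp: slab_eq strip_def)
qed

lemma slab_mono: "m \<le> n \<Longrightarrow> slab L (- real m) (real m) \<subseteq> slab L (- real n) (real n)"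
  by (auto simp: slab_eq)

lemma sets_slab [measurable]: "slab L c d \<in> sets borel"
  unfolding slab_def by simp

lemma sets_strip [measurable]: "strip L \<in> sets borel"
  unfolding strip_eq_UN_slab by measurable

lemma emeasure_cell: "L > 0 \<Longrightarrow> emeasure lborel (cell L :: (real ^ 'n::finite) set) = ennreal (L ^ CARD('n))"
proof -
  assume "L > 0"
  have "cbox 0 (\<chi> i. L) \<noteq> ({} :: (real ^ 'n) set)"
    unfolding interval_ne_empty_cart using \<open>L > 0\<close> by simp
  hence "measure lborel (cell L :: (real ^ 'n) set) = L ^ CARD('n)"
    unfolding cell_def by (subst content_cbox_cart) auto
  thus ?thesis
    unfolding cell_def using emeasure_lborel_cbox_finite[of 0 "\<chi> i. L :: real ^ 'n"]
    by (subst emeasure_eq_ennreal_measure) auto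
qed

lemma measure_cell: "L > 0 \<Longrightarrow> measure lborel (cell L :: (real ^ 'n::finite) set) = L ^ CARD('n)"
  by (simp add: measure_def emeasure_cell)

lemma set_integrable_slab:
  "strip_integrable L f \<Longrightarrow> set_integrable lborel (slab L c d) f"
  unfolding strip_integrable_def by (rule set_integrable_subset[OF _ _ slab_subset_strip]) auto

lemma integrable_on_slab:
  "strip_integrable L f \<Longrightarrow> f integrable_on slab L c d"
  by (rule set_borel_integral_eq_integral[OF set_integrable_slab])

lemma slab_integral_tendsto:
  fixes f :: "'n::finite point \<Rightarrow> real"
  assumes f: "strip_integrable L f" and "L > 0"
  shows "(\<lambda>n. integral (slab L (- real n) (real n)) f) \<longlonglongrightarrow> L ^ CARD('n) * strip_integral L f"
proof -
  have "(\<lambda>n. LINT x:slab L (- real n) (real n)|lborel. f x) \<longlonglongrightarrow> (LINT x:strip L|lborel. f x)"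
    unfolding strip_eq_UN_slab
    using f slab_mono
    by (intro set_integral_cont_up) (auto simp: incseq_def strip_integrable_def simp flip: strip_eq_UN_slab)
  thus ?thesis
    using set_borel_integral_eq_integral[OF set_integrable_slab[OF f]] \<open>L > 0\<close>
    by (simp add: strip_integral_def)
qed

lemma slab_integral_le:
  fixes f :: "'n::finite point \<Rightarrow> real"
  assumes f: "strip_integrable L f" and "L > 0" and "\<And>x. x \<in> strip L \<Longrightarrow> f x \<ge> 0"
  shows "integral (slab L c d) f \<le> L ^ CARD('n) * strip_integral L f"
proof -
  have "(LINT x:slab L c d|lborel. f x) \<le> (LINT x:strip L|lborel. f x)"
    unfolding set_lebesgue_integral_def
  proof (rule integral_mono)
    show "indicator (slab L c d) x *\<^sub>R f x \<le> indicator (strip L) x *\<^sub>R f x" for x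
      using assms(3)[of x] subsetD[OF slab_subset_strip, of x L c d] by (auto simp: indicator_def)
  qed (use f set_integrable_slab[OF f] in \<open>auto simp: strip_integrable_def set_integrable_def\<close>)
  thus ?thesis
    using set_borel_integral_eq_integral[OF set_integrable_slab[OF f]] \<open>L > 0\<close>
    by (simp add: strip_integral_def)
qed

text \<open>Meant for integrands whose integrability over the strip is not given: a bound uniform
  over slabs passes to the strip by monotone convergence and brings finiteness with it.\<close>

lemma nn_integral_strip_le:
  fixes f :: "'n::finite point \<Rightarrow> real"
  assumes cont: "continuous_on UNIV f" and nn: "\<And>x. f x \<ge> 0"
    and le: "\<And>n. integral (slab L (- real n) (real n)) f \<le> C"
  shows "(\<integral>\<^sup>+x\<in>strip L. ennreal (f x) \<partial>lborel) \<le> ennreal C"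
proof -
  have [measurable]: "f \<in> borel_measurable borel" using cont by (rule borel_measurable_continuous_onI)
  let ?g = "\<lambda>n x. ennreal (f x) * indicator (slab L (- real n) (real n)) x"
  have ind: "indicator (strip L) x = (SUP n. indicator (slab L (- real n) (real n)) x :: ennreal)" for x :: "'n point"
  proof (rule SUP_eqI[symmetric])
    show "indicator (slab L (- real n) (real n)) x \<le> (indicator (strip L) x :: ennreal)" for n
      using slab_subset_strip by (auto simp: indicator_def)
    fix y :: ennreal
    assume "\<And>n. n \<in> UNIV \<Longrightarrow> indicator (slab L (- real n) (real n)) x \<le> y"
    thus "indicator (strip L) x \<le> y"
      unfolding strip_eq_UN_slab by (cases "x \<in> (\<Union>n. slab L (- real n) (real n))") (auto, metis indicator_simps(1))
  qed
  have "(\<integral>\<^sup>+x\<in>strip L. ennreal (f x) \<partial>lborel) = (\<integral>\<^sup>+x. (SUP n. ?g n x) \<partial>lborel)"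
    unfolding ind by (simp add: SUP_mult_left_ennreal)
  also have "\<dots> = (SUP n. \<integral>\<^sup>+x. ?g n x \<partial>lborel)"
  proof (rule nn_integral_monotone_convergence_SUP)
    show "incseq ?g"
    proof (intro incseq_SucI le_funI mult_left_mono)
      fix n and x :: "'n point"
      show "indicator (slab L (- real n) (real n)) x \<le> (indicator (slab L (- real (Suc n)) (real (Suc n))) x :: ennreal)"
        using slab_mono[of n "Suc n" L] by (auto simp: indicator_def)
    qed auto
  qed measurable
  also have "\<dots> \<le> ennreal C"
  proof (rule SUP_least)
    fix n
    have "(\<integral>\<^sup>+x. ?g n x \<partial>lborel) = ennreal (integral (slab L (- real n) (real n)) f)"
      using nn unfolding slab_def
      by (intro nn_integral_has_integral_lebesgue' integrable_integral integrable_continuous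
          continuous_on_subset[OF cont]) auto
    also have "\<dots> \<le> ennreal C" by (intro ennreal_leI le)
    finally show "(\<integral>\<^sup>+x. ?g n x \<partial>lborel) \<le> ennreal C" .
  qed
  finally show ?thesis .
qed

text \<open>Tonelli: for a function of the height alone, the volume of the cell cancels against the
  normalization.\<close>

lemma strip_integral_profile:
  fixes f :: "real \<Rightarrow> real" and L :: real
  assumes [measurable]: "f \<in> borel_measurable borel" and "L > 0" "K \<ge> 0" and nn: "\<And>z. f z \<ge> 0"
    and K: "(\<integral>\<^sup>+z. ennreal (f z) \<partial>lborel) \<le> ennreal K"
  shows "strip_integrable L (\<lambda>x :: 'n::finite point. f (snd x))"
    and "strip_integral L (\<lambda>x :: 'n point. f (snd x)) \<le> K"
proof -
  let ?f = "\<lambda>x :: 'n point. indicator (strip L) x *\<^sub>R f (snd x)"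
  have m: "?f \<in> borel_measurable lborel"
    using borel_measurable_continuous_onI[OF continuous_on_snd[OF continuous_on_id, of "UNIV :: 'n point set"]]
    by simp
  have "(\<integral>\<^sup>+x. ennreal (?f x) \<partial>lborel)
     = (\<integral>\<^sup>+x. ennreal (?f x) \<partial>(lborel \<Otimes>\<^sub>M lborel))" by (simp add: lborel_prod)
  also have "\<dots> = (\<integral>\<^sup>+y. \<integral>\<^sup>+z. ennreal (?f (y, z)) \<partial>lborel \<partial>lborel)"
    using m by (intro lborel.nn_integral_fst[symmetric]) (simp add: lborel_prod)
  also have "\<dots> = (\<integral>\<^sup>+(y :: real ^ 'n). indicator (cell L) y * (\<integral>\<^sup>+z. ennreal (f z) \<partial>lborel) \<partial>lborel)"
  proof (rule nn_integral_cong)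
    fix y :: "real ^ 'n"
    have "(\<integral>\<^sup>+z. ennreal (?f (y, z)) \<partial>lborel) = (\<integral>\<^sup>+z. indicator (cell L) y * ennreal (f z) \<partial>lborel)"
      by (intro nn_integral_cong) (auto simp: indicator_def strip_def)
    thus "(\<integral>\<^sup>+z. ennreal (?f (y, z)) \<partial>lborel) = indicator (cell L) y * (\<integral>\<^sup>+z. ennreal (f z) \<partial>lborel)"
      by (simp add: nn_integral_cmult)
  qed
  also have "\<dots> = emeasure lborel (cell L :: (real ^ 'n) set) * (\<integral>\<^sup>+z. ennreal (f z) \<partial>lborel)"
    by (simp add: nn_integral_multc cell_def)
  also have "\<dots> \<le> ennreal (L ^ CARD('n)) * ennreal K"
    using \<open>L > 0\<close> by (intro mult_mono K) (auto simp: emeasure_cell)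
  also have "\<dots> = ennreal (L ^ CARD('n) * K)" using \<open>L > 0\<close> by (simp add: ennreal_mult')
  finally have le: "(\<integral>\<^sup>+x. ennreal (?f x) \<partial>lborel) \<le> ennreal (L ^ CARD('n) * K)" .
  have nnf: "?f x \<ge> 0" for x using nn by simp
  have int: "integrable lborel ?f"
    using m nnf le by (intro integrableI_nonneg) (auto simp: le_less_trans)
  thus "strip_integrable L (\<lambda>x :: 'n::finite point. f (snd x))"
    by (simp add: strip_integrable_def set_integrable_def)
  have "(LINT x:strip L|lborel. f (snd (x :: 'n point))) \<le> L ^ CARD('n) * K"
    unfolding set_lebesgue_integral_def
    using le \<open>L > 0\<close> \<open>K \<ge> 0\<close> nnf m
    by (subst integral_eq_nn_integral) (auto simp: enn2real_leI)
  thus "strip_integral L (\<lambda>x :: 'n point. f (snd x)) \<le> K"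
    using \<open>L > 0\<close> by (simp add: strip_integral_def field_simps)
qed

lemma strip_integral_mono:
  assumes "strip_integrable L f" "strip_integrable L h" "L > 0" "\<And>x. f x \<le> h x"
  shows "strip_integral L f \<le> strip_integral L h"
  unfolding strip_integral_def using assms
  by (intro mult_left_mono set_integral_mono) (auto simp: strip_integrable_def)

lemma strip_integral_linear:
  assumes "strip_integrable L f" "strip_integrable L h"
  shows "strip_integrable L (\<lambda>x. a * f x + b * h x)"
    and "strip_integral L (\<lambda>x. a * f x + b * h x) = a * strip_integral L f + b * strip_integral L h"
  using assms unfolding strip_integrable_def strip_integral_def
  by (auto simp: algebra_simps intro!: set_integral_add set_integrable_mult_right)

lemma set_integrable_cell:
  fixes f :: "'n::finite point \<Rightarrow> real"
  assumes "continuous_on UNIV f"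
  shows "set_integrable lborel (cell L) (\<lambda>y. f (y, z))"
  unfolding set_integrable_def cell_def
  by (intro borel_integrable_compact continuous_on_compose2[OF assms] continuous_intros) auto

lemma set_integral_cell:
  fixes f :: "'n::finite point \<Rightarrow> real"
  assumes "continuous_on UNIV f"
  shows "(LINT y:cell L|lborel. f (y, z)) = integral (cell L) (\<lambda>y. f (y, z))"
  by (rule set_borel_integral_eq_integral(2)[OF set_integrable_cell[OF assms]])

lemma no_boundary_term_tendsto:
  fixes f :: "'n::finite point \<Rightarrow> real"
  assumes "no_boundary_term L f" "continuous_on UNIV f"
  shows "(\<lambda>n. integral (cell L) (\<lambda>y. f (y, real n))) \<longlonglongrightarrow> 0"
    and "(\<lambda>n. integral (cell L) (\<lambda>y. f (y, - real n))) \<longlonglongrightarrow> 0"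
proof -
  have "((\<lambda>z. integral (cell L) (\<lambda>y. f (y, z))) \<longlongrightarrow> 0) at_top"
    "((\<lambda>z. integral (cell L) (\<lambda>y. f (y, z))) \<longlongrightarrow> 0) at_bot"
    using assms unfolding no_boundary_term_def by (simp_all add: set_integral_cell)
  thus "(\<lambda>n. integral (cell L) (\<lambda>y. f (y, real n))) \<longlonglongrightarrow> 0"
    and "(\<lambda>n. integral (cell L) (\<lambda>y. f (y, - real n))) \<longlonglongrightarrow> 0"
    using filterlim_compose[OF _ filterlim_real_sequentially]
      filterlim_compose[OF _ filterlim_compose[OF filterlim_uminus_at_bot_at_top filterlim_real_sequentially]]
    by blast+
qed

text \<open>Both section fluxes left over by \<open>slab_by_parts\<close> tend to 0. The limit over
  symmetric slabs stands in for an integral over the strip, because the divergence itself need not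
  be integrable there.\<close>

lemma flux_tendsto_zero:
  fixes a :: "'n::finite point \<Rightarrow> real" and v :: "'n point \<Rightarrow> 'n point"
  assumes a: "\<And>x. (a has_derivative a' x) (at x)"
    and a': "\<And>b. b \<in> Basis \<Longrightarrow> continuous_on UNIV (\<lambda>x. a' x b)"
    and v: "\<And>x. (v has_derivative v' x) (at x)"
    and v': "\<And>b. b \<in> Basis \<Longrightarrow> continuous_on UNIV (\<lambda>x. v' x b)"
    and per: "y_periodic L a" "y_periodic L v" and "L > 0"
    and nb: "no_boundary_term L (\<lambda>x. a x * snd (v x))"
  shows "(\<lambda>n. integral (slab L (- real n) (real n)) (\<lambda>x. a x * (\<Sum>b\<in>Basis. v' x b \<bullet> b) + a' x (v x))) \<longlonglongrightarrow> 0"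
proof -
  have "continuous_on UNIV a" "continuous_on UNIV v"
    by (auto intro!: continuous_at_imp_continuous_on has_derivative_continuous[OF a] has_derivative_continuous[OF v])
  hence "continuous_on UNIV (\<lambda>x. a x * snd (v x))" by (intro continuous_intros)
  note lim = no_boundary_term_tendsto[OF nb this]
  show ?thesis
    using tendsto_diff[OF lim] by (simp add: slab_by_parts[OF a a' v v' per \<open>L > 0\<close>])
qed

lemma flux_integrand_continuous:
  fixes a :: "'a::euclidean_space \<Rightarrow> real" and v :: "'a \<Rightarrow> 'a"
  assumes a: "\<And>x. (a has_derivative a' x) (at x)"
    and a': "\<And>b. b \<in> Basis \<Longrightarrow> continuous_on UNIV (\<lambda>x. a' x b)"
    and v: "\<And>x. (v has_derivative v' x) (at x)"
    and v': "\<And>b. b \<in> Basis \<Longrightarrow> continuous_on UNIV (\<lambda>x. v' x b)"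
  shows "continuous_on UNIV (\<lambda>x. a x * (\<Sum>b\<in>Basis. v' x b \<bullet> b) + a' x (v x))"
proof -
  have "continuous_on UNIV a" and contv: "continuous_on UNIV v"
    by (auto intro!: continuous_at_imp_continuous_on has_derivative_continuous[OF a] has_derivative_continuous[OF v])
  moreover have "(\<lambda>x. a' x (v x)) = (\<lambda>x. \<Sum>b\<in>Basis. (v x \<bullet> b) * a' x b)"
  proof
    fix x
    have "a' x (v x) = a' x (\<Sum>b\<in>Basis. (v x \<bullet> b) *\<^sub>R b)" by (simp add: euclidean_representation)
    thus "a' x (v x) = (\<Sum>b\<in>Basis. (v x \<bullet> b) * a' x b)"
      using has_derivative_linear[OF a, of x] by (simp add: linear_sum linear_cmul)
  qed
  ultimately show ?thesis using contv by (auto intro!: continuous_intros a' v' simp only:)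
qed

lemma continuous_integrable_on_slab:
  fixes f :: "'n::finite point \<Rightarrow> real"
  shows "continuous_on UNIV f \<Longrightarrow> f integrable_on slab L c d"
  unfolding slab_def by (intro integrable_continuous) (rule continuous_on_subset, auto)

section \<open>Classical solutions\<close>

lemma frechet_derivative_eq_grad:
  fixes f :: "'a::euclidean_space \<Rightarrow> real"
  assumes "f differentiable (at x)"
  shows "frechet_derivative f (at x) h = grad f x \<bullet> h"
proof -
  have l: "linear (frechet_derivative f (at x))"
    using assms by (simp add: linear_frechet_derivative)
  have "frechet_derivative f (at x) h = frechet_derivative f (at x) (\<Sum>b\<in>Basis. (h \<bullet> b) *\<^sub>R b)"
    by (simp add: euclidean_representation)
  also have "\<dots> = (\<Sum>b\<in>Basis. (h \<bullet> b) * frechet_derivative f (at x) b)"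
    using l by (simp add: linear_sum linear_cmul)
  also have "\<dots> = grad f x \<bullet> h"
    unfolding grad_def inner_sum_left by (intro sum.cong) (auto simp: inner_commute)
  finally show ?thesis .
qed

lemma has_derivative_grad:
  fixes f :: "'a::euclidean_space \<Rightarrow> real"
  assumes "f differentiable (at x)"
  shows "(f has_derivative (\<lambda>h. grad f x \<bullet> h)) (at x)"
proof -
  have "frechet_derivative f (at x) = (\<lambda>h. grad f x \<bullet> h)"
    using frechet_derivative_eq_grad[OF assms] by blast
  thus ?thesis using assms by (metis frechet_derivative_works)
qed

lemma y_periodic_grad:
  fixes f :: "'n::finite point \<Rightarrow> real"
  assumes "\<And>x. f differentiable (at x)" "y_periodic L f"
  shows "y_periodic L (grad f)"
  unfolding y_periodic_def
proof (intro allI)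
  fix i :: 'n and y z
  let ?a = "(axis i L, 0) :: 'n point"
  have "((\<lambda>x. f (x + ?a)) has_derivative frechet_derivative f (at ((y, z) + ?a))) (at (y, z))"
    by (rule has_derivative_compose[where g = f, of "\<lambda>x. x + ?a", simplified])
       (use assms(1)[of "(y, z) + ?a"] in \<open>auto simp: frechet_derivative_works intro!: derivative_eq_intros\<close>)
  moreover have "(\<lambda>x. f (x + ?a)) = f" using assms(2) by (auto simp: y_periodic_def)
  ultimately have "frechet_derivative f (at (y, z)) = frechet_derivative f (at ((y, z) + ?a))"
    by (metis frechet_derivative_at)
  thus "grad f (y + axis i L, z) = grad f (y, z)" by (simp add: grad_def)
qed

lemma C1_on_slice:
  fixes f :: "real \<Rightarrow> 'a::euclidean_space \<Rightarrow> 'b::euclidean_space"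
  assumes "C1_on (\<lambda>(t, x). f t x) ({0<..} \<times> UNIV)" and "t > 0"
  shows "(f t has_derivative frechet_derivative (f t) (at x)) (at x)"
    and "b \<in> Basis \<Longrightarrow> continuous_on UNIV (\<lambda>x. frechet_derivative (f t) (at x) b)"
    and "((\<lambda>s. f s x) has_vector_derivative vector_derivative (\<lambda>s. f s x) (at t)) (at t)"
proof -
  let ?J = "\<lambda>q. frechet_derivative (\<lambda>(t, x). f t x) (at q)"
  have J: "((\<lambda>(t, x). f t x) has_derivative ?J (t, x)) (at (t, x))" for x
    using assms unfolding C1_on_def by (simp add: frechet_derivative_works)
  have sl: "(f t has_derivative (\<lambda>h. ?J (t, x) (0, h))) (at x)" for x
  proof -
    have "((\<lambda>x. (t, x)) has_derivative (\<lambda>h. (0, h))) (at x)"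
      by (auto intro!: derivative_eq_intros)
    from has_derivative_compose[OF this J] show ?thesis by simp
  qed
  hence eq: "frechet_derivative (f t) (at x) = (\<lambda>h. ?J (t, x) (0, h))" for x
    by (metis frechet_derivative_at)
  show "(f t has_derivative frechet_derivative (f t) (at x)) (at x)" using sl eq by simp
  show "continuous_on UNIV (\<lambda>x. frechet_derivative (f t) (at x) b)" if "b \<in> Basis"
  proof -
    have "continuous_on ({0<..} \<times> UNIV) (\<lambda>q. ?J q (0, b))"
      using assms that unfolding C1_on_def by (auto simp: Basis_prod_def)
    moreover have "continuous_on UNIV (\<lambda>x :: 'a. (t, x))" by (intro continuous_intros)
    ultimately show ?thesis
      unfolding eq using \<open>t > 0\<close> by (auto elim!: continuous_on_compose2)
  qed
  have "((\<lambda>s. f s x) has_derivative (\<lambda>h. ?J (t, x) (h, 0))) (at t)"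
  proof -
    have "((\<lambda>s. (s, x)) has_derivative (\<lambda>h. (h, 0))) (at t)"
      by (auto intro!: derivative_eq_intros)
    from has_derivative_compose[OF this J] show ?thesis by simp
  qed
  hence "(\<lambda>s. f s x) differentiable (at t)" unfolding differentiable_def by blast
  thus "((\<lambda>s. f s x) has_vector_derivative vector_derivative (\<lambda>s. f s x) (at t)) (at t)"
    by (simp add: vector_derivative_works)
qed

section \<open>The solution, its derivatives and the equations in pointwise form\<close>

locale rayleigh_taylor =
  fixes L g rp rm :: real
    and rho :: "real \<Rightarrow> 'n::finite point \<Rightarrow> real"
    and u :: "real \<Rightarrow> 'n point \<Rightarrow> 'n point"
    and p :: "real \<Rightarrow> 'n point \<Rightarrow> real"
  assumes L: "L > 0" and g: "g > 0" and rm: "rm > 0" and rp: "rp > rm"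
    and sol: "classical_solution L g rp rm rho u p"
begin

lemma smooth: "smooth_solution g rho u p"
  using sol by (simp add: classical_solution_def)

lemma C1_rho: "C1_on (\<lambda>(t, x). rho t x) ({0<..} \<times> UNIV)"
  and C1_u: "C1_on (\<lambda>(t, x). u t x) ({0<..} \<times> UNIV)"
  and C1_p: "t > 0 \<Longrightarrow> C1_on (p t) UNIV"
  using smooth unfolding smooth_solution_def by blast+

lemma second_derivatives:
  "b \<in> Basis \<Longrightarrow> t > 0 \<Longrightarrow> (\<lambda>x'. frechet_derivative (rho t) (at x') b) differentiable (at x)"
  "b \<in> Basis \<Longrightarrow> c \<in> Basis \<Longrightarrow> continuous_on ({0<..} \<times> UNIV)
     (\<lambda>(t, x). frechet_derivative (\<lambda>x'. frechet_derivative (rho t) (at x') b) (at x) c)"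
  using smooth unfolding smooth_solution_def by blast+

lemma equations:
  assumes "t > 0"
  shows "vector_derivative (\<lambda>s. rho s x) (at t) + u t x \<bullet> grad (rho t) x - laplacian (rho t) x = 0"
    "rho t x *\<^sub>R (vector_derivative (\<lambda>s. u s x) (at t) + dir_deriv (u t x) (u t) x)
          - dir_deriv (grad (rho t) x) (u t) x + grad (p t) x + (rho t x * g) *\<^sub>R e_z = 0"
    "divergence (u t) x = 0"
  using smooth assms unfolding smooth_solution_def by blast+

text \<open>The derivative of the density gradient as a linear map, with trace the Laplacian. In
  this form the gradient can serve as the vector field of \<open>slab_by_parts\<close>.\<close>

definition hess :: "real \<Rightarrow> 'n point \<Rightarrow> 'n point \<Rightarrow> 'n point" where
  "hess t x h = (\<Sum>b\<in>Basis. frechet_derivative (\<lambda>x'. frechet_derivative (rho t) (at x') b) (at x) h *\<^sub>R b)"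

definition Du :: "real \<Rightarrow> 'n point \<Rightarrow> 'n point \<Rightarrow> 'n point" where
  "Du t x = frechet_derivative (u t) (at x)"

definition ut :: "real \<Rightarrow> 'n point \<Rightarrow> 'n point" where
  "ut t x = vector_derivative (\<lambda>s. u s x) (at t)"

context
  fixes t :: real
  assumes t: "t > 0"
begin

lemma rho_differentiable: "rho t differentiable (at x)"
  using C1_on_slice(1)[OF C1_rho t] unfolding differentiable_def by blast

lemma rho_derivative: "(rho t has_derivative (\<lambda>h. grad (rho t) x \<bullet> h)) (at x)"
  by (rule has_derivative_grad[OF rho_differentiable])

lemma grad_rho_derivative: "(grad (rho t) has_derivative hess t x) (at x)"
proof -
  have "((\<lambda>x'. frechet_derivative (rho t) (at x') b) has_derivative
      frechet_derivative (\<lambda>x'. frechet_derivative (rho t) (at x') b) (at x)) (at x)" if "b \<in> Basis" for b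
    using second_derivatives(1)[OF that t] by (simp add: frechet_derivative_works)
  thus ?thesis
    unfolding grad_def[abs_def] hess_def[abs_def] by (auto intro!: derivative_eq_intros)
qed

lemma hess_continuous: "b \<in> Basis \<Longrightarrow> continuous_on UNIV (\<lambda>x. hess t x b)"
proof -
  assume b: "b \<in> Basis"
  have "continuous_on UNIV (\<lambda>x. frechet_derivative (\<lambda>x'. frechet_derivative (rho t) (at x') c) (at x) b)"
    if "c \<in> Basis" for c
  proof -
    have "continuous_on ({0<..} \<times> UNIV)
        (\<lambda>(t, x). frechet_derivative (\<lambda>x'. frechet_derivative (rho t) (at x') c) (at x) b)"
      using second_derivatives(2) b that by blast
    moreover have "continuous_on UNIV (\<lambda>x :: 'n point. (t, x))" by (intro continuous_intros)
    ultimately have "continuous_on UNIV (\<lambda>x. (\<lambda>(t, x). frechet_derivative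
        (\<lambda>x'. frechet_derivative (rho t) (at x') c) (at x) b) (t, x))"
      by (rule continuous_on_compose2) (use t in auto)
    thus ?thesis by simp
  qed
  thus ?thesis unfolding hess_def by (auto intro!: continuous_intros)
qed

lemma trace_hess: "(\<Sum>b\<in>Basis. hess t x b \<bullet> b) = laplacian (rho t) x"
  unfolding hess_def laplacian_def
  by (intro sum.cong) (auto simp: inner_sum_left inner_Basis if_distrib cong: if_cong)

lemma grad_rho_continuous: "continuous_on UNIV (grad (rho t))"
  by (auto intro!: continuous_at_imp_continuous_on has_derivative_continuous[OF grad_rho_derivative])

lemma rho_continuous: "continuous_on UNIV (rho t)"
  by (auto intro!: continuous_at_imp_continuous_on has_derivative_continuous[OF rho_derivative])

lemma laplacian_continuous: "continuous_on UNIV (laplacian (rho t))"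
proof -
  have "laplacian (rho t) = (\<lambda>x. \<Sum>b\<in>Basis. hess t x b \<bullet> b)" using trace_hess by auto
  thus ?thesis by (auto intro!: continuous_intros hess_continuous)
qed

lemma u_derivative: "(u t has_derivative Du t x) (at x)"
  unfolding Du_def by (rule C1_on_slice(1)[OF C1_u t])

lemma Du_continuous: "b \<in> Basis \<Longrightarrow> continuous_on UNIV (\<lambda>x. Du t x b)"
  unfolding Du_def by (rule C1_on_slice(2)[OF C1_u t])

lemma trace_Du: "(\<Sum>b\<in>Basis. Du t x b \<bullet> b) = 0"
  using equations(3)[OF t, of x] unfolding Du_def divergence_def .

lemma u_continuous: "continuous_on UNIV (u t)"
  by (auto intro!: continuous_at_imp_continuous_on has_derivative_continuous[OF u_derivative])

lemma p_derivative: "(p t has_derivative (\<lambda>h. grad (p t) x \<bullet> h)) (at x)"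
  using C1_p[OF t] unfolding C1_on_def by (intro has_derivative_grad) blast

lemma grad_p_continuous: "continuous_on UNIV (grad (p t))"
  using C1_p[OF t] unfolding C1_on_def grad_def[abs_def]
  by (auto intro!: continuous_intros)

lemma rho_time_derivative:
  "((\<lambda>s. rho s x) has_real_derivative laplacian (rho t) x - u t x \<bullet> grad (rho t) x) (at t)"
proof -
  have "((\<lambda>s. rho s x) has_vector_derivative vector_derivative (\<lambda>s. rho s x) (at t)) (at t)"
    by (rule C1_on_slice(3)[OF C1_rho t])
  moreover have "vector_derivative (\<lambda>s. rho s x) (at t) = laplacian (rho t) x - u t x \<bullet> grad (rho t) x"
    using equations(1)[OF t, of x] by simp
  ultimately show ?thesis by (simp add: has_real_derivative_iff_has_vector_derivative)
qed

lemma u_time_derivative: "((\<lambda>s. u s x) has_vector_derivative ut t x) (at t)"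
  unfolding ut_def by (rule C1_on_slice(3)[OF C1_u t])

lemma momentum:
  "rho t x *\<^sub>R ut t x = - (rho t x *\<^sub>R Du t x (u t x)) + Du t x (grad (rho t) x) - grad (p t) x - (rho t x * g) *\<^sub>R e_z"
proof -
  have "rho t x *\<^sub>R (ut t x + Du t x (u t x))
          - Du t x (grad (rho t) x) + grad (p t) x + (rho t x * g) *\<^sub>R e_z = 0"
    using equations(2)[OF t, of x] unfolding ut_def Du_def dir_deriv_def .
  thus ?thesis by (simp add: algebra_simps eq_neg_iff_add_eq_0)
qed

lemma periodic: "y_periodic L (rho t)" "y_periodic L (u t)" "y_periodic L (p t)" "y_periodic L (grad (rho t))"
  using sol t rho_differentiable by (auto simp: classical_solution_def intro!: y_periodic_grad)

lemma rho_bounds: "rm < rho t x" "rho t x < rp" "0 < rho t x"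
proof -
  have "rho t x \<in> {rm<..<rp}" using sol t unfolding classical_solution_def by blast
  thus "rm < rho t x" "rho t x < rp" "0 < rho t x" using rm by auto
qed

lemmas flux_rules = rho_derivative grad_rho_derivative u_derivative p_derivative

lemmas flux_continuous = rho_continuous grad_rho_continuous u_continuous laplacian_continuous
  hess_continuous Du_continuous grad_p_continuous

end

lemma regular:
  assumes "e \<in> {potential g rp rm, kinetic rp rm, mixing rp rm, entropy rp rm}"
  shows "t \<ge> 0 \<Longrightarrow> strip_integrable L (along e rho u t)"
    and "continuous_on {0..} (bulk L e rho u)"
    and "t > 0 \<Longrightarrow> strip_integrable L (\<lambda>x. deriv (\<lambda>s. along e rho u s x) t)"
    and "t > 0 \<Longrightarrow> (bulk L e rho u has_real_derivative
           strip_integral L (\<lambda>x. deriv (\<lambda>s. along e rho u s x) t)) (at t)"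
    and "t > 0 \<Longrightarrow> no_boundary_term L (\<lambda>x. along e rho u t x * snd (u t x))"
    and "t > 0 \<Longrightarrow> no_boundary_term L (\<lambda>x. deriv (\<lambda>r. e (snd x) r (u t x)) (rho t x) * snd (grad (rho t) x))"
  using sol assms unfolding classical_solution_def regular_bulk_def no_boundary_terms_def by blast+

end

section \<open>Evolution of the bulk quantities\<close>

definition entropy_slope :: "real \<Rightarrow> real \<Rightarrow> real \<Rightarrow> real" where
  "entropy_slope rp rm r = (ln ((rp - r) / (rp - rm)) - ln ((r - rm) / (rp - rm))) / (rp - rm)"

text \<open>The second derivative is minus the reciprocal of \<open>(rp - r) * (r - rm)\<close>, the
  weight in \<open>mixing\<close>. This pairing is what makes entropy production and
  \<open>H\<close> conjugate in the perimeter estimate.\<close>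

lemma entropy_has_derivative:
  assumes "rm < r" "r < rp"
  shows "((\<lambda>r. entropy rp rm z r v) has_real_derivative entropy_slope rp rm r) (at r)"
    and "(entropy_slope rp rm has_real_derivative - 1 / ((rp - r) * (r - rm))) (at r)"
proof -
  have d: "rp - rm > 0" "rp - r > 0" "r - rm > 0" using assms by auto
  have l3: "((\<lambda>r. (rp - r) / (rp - rm)) has_real_derivative - 1 / (rp - rm)) (at r)"
    and l4: "((\<lambda>r. (r - rm) / (rp - rm)) has_real_derivative 1 / (rp - rm)) (at r)"
    using DERIV_cdivide[OF DERIV_diff[OF DERIV_const[of rp] DERIV_ident], of "rp - rm"]
      DERIV_cdivide[OF DERIV_diff[OF DERIV_ident DERIV_const[of rm]], of "rp - rm"] by simp_all
  have l1: "((\<lambda>r. ln ((rp - r) / (rp - rm))) has_real_derivative - 1 / (rp - r)) (at r)"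
    using DERIV_chain2[OF DERIV_ln l3] d by (simp add: field_simps)
  have l2: "((\<lambda>r. ln ((r - rm) / (rp - rm))) has_real_derivative 1 / (r - rm)) (at r)"
    using DERIV_chain2[OF DERIV_ln l4] d by (simp add: field_simps)
  have deriv: "((\<lambda>r. entropy rp rm z r v) has_real_derivative
      - ((- 1 / (rp - rm)) * ln ((rp - r) / (rp - rm)) + (- 1 / (rp - r)) * ((rp - r) / (rp - rm)) +
         ((1 / (rp - rm)) * ln ((r - rm) / (rp - rm)) + (1 / (r - rm)) * ((r - rm) / (rp - rm))))) (at r)"
    unfolding entropy_def by (intro DERIV_minus DERIV_add DERIV_mult l1 l2 l3 l4)
  have cancel: "(- 1 / (rp - r)) * ((rp - r) / (rp - rm)) = - 1 / (rp - rm)"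
    "(1 / (r - rm)) * ((r - rm) / (rp - rm)) = 1 / (rp - rm)" using d by simp_all
  have regroup: "- ((- 1 / c) * a + - 1 / c + ((1 / c) * b + 1 / c)) = (a - b) / c" for a b c :: real
    by (simp add: diff_divide_distrib)
  show "((\<lambda>r. entropy rp rm z r v) has_real_derivative entropy_slope rp rm r) (at r)"
    using deriv[unfolded cancel regroup] by (simp only: entropy_slope_def)
  have "(entropy_slope rp rm has_real_derivative (- 1 / (rp - r) - 1 / (r - rm)) / (rp - rm)) (at r)"
    unfolding entropy_slope_def[abs_def] by (intro DERIV_cdivide DERIV_diff l1 l2)
  moreover have "(- 1 / (rp - r) - 1 / (r - rm)) / (rp - rm) = - 1 / ((rp - r) * (r - rm))"
    using d by (simp add: divide_simps)
  ultimately show "(entropy_slope rp rm has_real_derivative - 1 / ((rp - r) * (r - rm))) (at r)" by simp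
qed

lemma no_boundary_term_cmult:
  "no_boundary_term L f \<Longrightarrow> no_boundary_term L (\<lambda>x. c * f x)"
  unfolding no_boundary_term_def by (auto intro: tendsto_mult_right_zero)

lemma y_periodic_const: "y_periodic L (\<lambda>x. c)"
  by (simp add: y_periodic_def)

lemma integral_diff_add:
  fixes f h k :: "'a::euclidean_space \<Rightarrow> real"
  assumes "f integrable_on S" "h integrable_on S" "k integrable_on S"
  shows "integral S (\<lambda>x. f x - h x + k x) = integral S f - integral S h + integral S k"
  using assms by (simp add: integral_add integral_diff integrable_diff)

context rayleigh_taylor
begin

abbreviation "bulk_rate e t \<equiv> strip_integral L (\<lambda>x. deriv (\<lambda>s. along e rho u s x) t)"
abbreviation "symmetric_slab n \<equiv> slab L (- real n) (real n)"
abbreviation "dissipation t x \<equiv> (norm (grad (rho t) x))\<^sup>2 / ((rp - rho t x) * (rho t x - rm))"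

text \<open>Here \<open>f\<close> is what remains of the time derivative once the divergences
  \<open>B1\<close> and \<open>B2\<close> are split off. Only the time derivative is integrable by
  assumption, hence a limit of slab integrals in place of an integral of \<open>f\<close>.\<close>

lemma bulk_rate_tendsto:
  assumes "e \<in> {potential g rp rm, kinetic rp rm, mixing rp rm, entropy rp rm}" "t > 0"
    and f: "\<And>x. f x = deriv (\<lambda>s. along e rho u s x) t - B1 x + B2 x"
    and B: "continuous_on UNIV B1" "continuous_on UNIV B2"
      "(\<lambda>n. integral (symmetric_slab n) B1) \<longlonglongrightarrow> 0" "(\<lambda>n. integral (symmetric_slab n) B2) \<longlonglongrightarrow> 0"
  shows "(\<lambda>n. integral (symmetric_slab n) f) \<longlonglongrightarrow> L ^ CARD('n) * bulk_rate e t"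
proof -
  note reg = regular(3)[OF assms(1,2)]
  have "integral (symmetric_slab n) f = integral (symmetric_slab n) (\<lambda>x. deriv (\<lambda>s. along e rho u s x) t)
      - integral (symmetric_slab n) B1 + integral (symmetric_slab n) B2" for n
    unfolding f using B by (intro integral_diff_add integrable_on_slab[OF reg] continuous_integrable_on_slab)
  thus ?thesis
    using tendsto_add[OF tendsto_diff[OF slab_integral_tendsto[OF reg L] B(3)] B(4)] by simp
qed

text \<open>By the density equation the entropy density changes at the rate slope times (Laplacian
  minus advection). Up to the divergences of the diffusive flux and of the advective flux, what is
  left is minus the second derivative of the entropy times the squared gradient, that is,
  \<open>dissipation\<close>.\<close>

lemma entropy_production:
  assumes t: "t > 0"
  shows "(\<lambda>n. integral (symmetric_slab n) (dissipation t)) \<longlonglongrightarrow> L ^ CARD('n) * bulk_rate (entropy rp rm) t"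
proof -
  let ?r = "rho t" and ?s = "entropy_slope rp rm"
  note b = rho_bounds[OF t]
  define a1 where "a1 x = ?s (?r x)" for x
  define a1' where "a1' x h = - 1 / ((rp - ?r x) * (?r x - rm)) * (grad ?r x \<bullet> h)" for x h
  define a2 where "a2 x = entropy rp rm (snd x) (?r x) (u t x)" for x
  define a2' where "a2' x h = ?s (?r x) * (grad ?r x \<bullet> h)" for x h
  have a1: "(a1 has_derivative a1' x) (at x)" for x
    using has_derivative_compose[OF rho_derivative[OF t]
        entropy_has_derivative(2)[OF b(1)[of x] b(2)[of x], unfolded has_field_derivative_def]]
    unfolding a1_def[abs_def] a1'_def[abs_def] .
  have a2: "(a2 has_derivative a2' x) (at x)" for x
  proof -
    have "a2 = (\<lambda>x. entropy rp rm 0 (?r x) (0 :: 'n point))" by (simp add: a2_def entropy_def fun_eq_iff)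
    moreover have "((\<lambda>x. entropy rp rm 0 (?r x) (0 :: 'n point)) has_derivative a2' x) (at x)"
      using has_derivative_compose[OF rho_derivative[OF t]
        entropy_has_derivative(1)[OF b(1)[of x] b(2)[of x], unfolded has_field_derivative_def]]
      unfolding a2'_def[abs_def] .
    ultimately show ?thesis by simp
  qed
  have cont: "continuous_on UNIV a1"
    by (auto intro!: continuous_at_imp_continuous_on has_derivative_continuous[OF a1])
  have nz: "rp - ?r x \<noteq> 0" "?r x - rm \<noteq> 0" for x using b[of x] by auto
  have a1': "continuous_on UNIV (\<lambda>x. a1' x b)" for b
    unfolding a1'_def by (intro continuous_intros flux_continuous[OF t]) (use nz in auto)
  have a2': "continuous_on UNIV (\<lambda>x. a2' x b)" for b
    unfolding a2'_def a1_def[symmetric] by (intro continuous_intros cont flux_continuous[OF t])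
  have per: "y_periodic L a1" "y_periodic L a2"
    using periodic[OF t] by (auto simp: y_periodic_def a1_def a2_def entropy_def)
  have dr: "deriv (\<lambda>r. entropy rp rm z r v) (?r x) = ?s (?r x)" for z v x
    by (intro DERIV_imp_deriv entropy_has_derivative b)
  have nb: "no_boundary_term L (\<lambda>x. a1 x * snd (grad ?r x))" "no_boundary_term L (\<lambda>x. a2 x * snd (u t x))"
    using regular(5,6)[OF _ t, of "entropy rp rm"] by (simp_all add: dr a1_def a2_def along_def)
  have dt: "deriv (\<lambda>s. along (entropy rp rm) rho u s x) t = ?s (?r x) * (laplacian ?r x - u t x \<bullet> grad ?r x)" for x
  proof -
    have "(\<lambda>s. along (entropy rp rm) rho u s x) = (\<lambda>s. entropy rp rm 0 (rho s x) (0 :: 'n point))"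
      by (simp add: along_def entropy_def fun_eq_iff)
    thus ?thesis
      by (auto intro!: DERIV_imp_deriv DERIV_chain2[OF entropy_has_derivative(1)[OF b(1)[of x] b(2)[of x]] rho_time_derivative[OF t]])
  qed
  show ?thesis
  proof (rule bulk_rate_tendsto[OF _ t])
    show "dissipation t x = deriv (\<lambda>s. along (entropy rp rm) rho u s x) t
        - (a1 x * (\<Sum>b\<in>Basis. hess t x b \<bullet> b) + a1' x (grad ?r x))
        + (a2 x * (\<Sum>b\<in>Basis. Du t x b \<bullet> b) + a2' x (u t x))" for x
      unfolding dt trace_hess[OF t] trace_Du[OF t] a1_def a1'_def a2'_def power2_norm_eq_inner
      by (simp add: algebra_simps inner_commute)
  qed (use t L in \<open>auto intro!: flux_integrand_continuous flux_tendsto_zero a1 a2 a1' a2' flux_rules flux_continuous per periodic nb\<close>)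
qed

section \<open>Vanishing of the horizontal mean of the vertical velocity\<close>

lemma vertical_flux_constant:
  assumes t: "t > 0" and "c \<le> d"
  shows "integral (cell L) (\<lambda>y. snd (u t (y, c))) = integral (cell L) (\<lambda>y. snd (u t (y, d)))"
proof -
  have "integral (slab L c d) (\<lambda>x. 1 * (\<Sum>b\<in>Basis. Du t x b \<bullet> b) + (\<lambda>h. 0) (u t x))
    = integral (cell L) (\<lambda>y. 1 * snd (u t (y, d))) - integral (cell L) (\<lambda>y. 1 * snd (u t (y, c)))"
    by (rule slab_by_parts[where a = "\<lambda>_. 1" and a' = "\<lambda>_ _. 0"])
       (use t L \<open>c \<le> d\<close> in \<open>auto intro: flux_rules flux_continuous periodic y_periodic_const\<close>)
  thus ?thesis by (simp add: trace_Du[OF t])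
qed

lemma slab_integral_flux:
  fixes c :: "real \<Rightarrow> real"
  assumes t: "t > 0" and c: "continuous_on UNIV c"
  shows "integral (slab L z1 z2) (\<lambda>x. c (snd x) * snd (u t x))
    = integral {z1..z2} (\<lambda>z. c z * integral (cell L) (\<lambda>y. snd (u t (y, z))))"
proof -
  let ?f = "\<lambda>x. c (snd x) * snd (u t x)"
  have cont: "continuous_on UNIV ?f"
    by (intro continuous_intros continuous_on_compose2[OF c] flux_continuous[OF t]) auto
  have "integral (slab L z1 z2) ?f
      = integral (cell L) (\<lambda>y. integral (cbox z1 z2) (\<lambda>z. ?f (y, z)))"
    unfolding slab_def cell_def by (intro integral_prod_continuous continuous_on_subset[OF cont]) auto
  also have "\<dots> = integral (cbox z1 z2) (\<lambda>z. integral (cell L) (\<lambda>y. ?f (y, z)))"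
    unfolding cell_def
    by (rule integral_swap_continuous) (auto simp: case_prod_eta intro!: continuous_on_subset[OF cont] simp del: fst_conv snd_conv)
  finally show ?thesis by simp
qed

lemma kinetic_nonneg: "t > 0 \<Longrightarrow> along (kinetic rp rm) rho u t x \<ge> 0"
  using rho_bounds[of t x] rp by (simp add: along_def kinetic_def)

text \<open>
  The velocity is only known to decay pointwise, so the constant flux is forced to vanish
  by comparison with the finite kinetic energy.
\<close>

lemma vertical_flux_zero:
  assumes t: "t > 0"
  shows "integral (cell L) (\<lambda>y. snd (u t (y, z))) = 0"
proof -
  define W where "W = integral (cell L) (\<lambda>y. snd (u t (y, 0)))"
  have W: "integral (cell L) (\<lambda>y. snd (u t (y, z))) = W" for z
    unfolding W_def using vertical_flux_constant[OF t, of 0 z] vertical_flux_constant[OF t, of z 0] by linarith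
  let ?E = "L ^ CARD('n) * bulk L (kinetic rp rm) rho u t"
  note kin = regular(1)[of "kinetic rp rm" t]
  \<comment> \<open>Young's inequality with weight \<open>d\<close>, integrated over a slab of
    height \<open>2 * real n\<close> and divided by that height. The kinetic part disappears as
    \<open>n\<close> grows, and afterwards \<open>d\<close> tends to 0.\<close>
  have le: "\<bar>W\<bar> \<le> d * (L ^ CARD('n) / 2) + ((rp - rm) / (rm * d) * ?E / 2) * (1 / real n)"
    if d: "d > 0" and n: "n > 0" for d :: real and n :: nat
  proof -
    let ?S = "symmetric_slab n :: 'n point set"
    have intu: "(\<lambda>x. snd (u t x)) integrable_on ?S"
      by (intro continuous_integrable_on_slab continuous_intros flux_continuous[OF t])
    have int1: "(\<lambda>x. d / 2) integrable_on ?S"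
      by (intro continuous_integrable_on_slab continuous_intros)
    have "along (kinetic rp rm) rho u t integrable_on ?S"
      using kin t by (intro integrable_on_slab) auto
    hence int2: "(\<lambda>x. (rp - rm) / (rm * d) * along (kinetic rp rm) rho u t x) integrable_on ?S"
      by (rule integrable_on_mult_right)
    note intb = integrable_add[OF int1 int2]
    have b: "\<bar>snd (u t x)\<bar> \<le> d / 2 + (rp - rm) / (rm * d) * along (kinetic rp rm) rho u t x" for x
    proof -
      have "\<bar>snd (u t x)\<bar> \<le> d / 2 + (snd (u t x))\<^sup>2 / (2 * d)"
      proof -
        have "0 \<le> (d - \<bar>snd (u t x)\<bar>)\<^sup>2" by simp
        thus ?thesis using d by (simp add: field_simps power2_eq_square)
      qed
      also have "(snd (u t x))\<^sup>2 / (2 * d) \<le> (rp - rm) / (rm * d) * along (kinetic rp rm) rho u t x"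
      proof -
        have "(snd (u t x))\<^sup>2 \<le> (norm (u t x))\<^sup>2" 
          by (cases "u t x") (simp add: norm_Pair)
        hence "rm * (snd (u t x))\<^sup>2 \<le> rho t x * (norm (u t x))\<^sup>2"
          using rho_bounds[OF t, of x] rm by (intro mult_mono) auto
        hence "(snd (u t x))\<^sup>2 / (2 * d) \<le> (rho t x * (norm (u t x))\<^sup>2) / rm / (2 * d)"
          using d rm by (intro divide_right_mono) (auto simp: field_simps)
        also have "\<dots> = (rp - rm) / (rm * d) * along (kinetic rp rm) rho u t x"
          using d rm rp by (simp add: along_def kinetic_def del: right_diff_distrib_numeral)
        finally show ?thesis .
      qed
      finally show ?thesis by simp
    qed
    have "2 * real n * \<bar>W\<bar> = \<bar>integral ?S (\<lambda>x. 1 * snd (u t x))\<bar>"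
      by (subst slab_integral_flux[OF t]) (auto simp: W abs_mult)
    also have "\<dots> \<le> integral ?S (\<lambda>x. d / 2 + (rp - rm) / (rm * d) * along (kinetic rp rm) rho u t x)"
      using integral_norm_bound_integral[OF intu intb] b by simp
    also have "\<dots> = d / 2 * (L ^ CARD('n) * (2 * real n))
        + (rp - rm) / (rm * d) * integral ?S (along (kinetic rp rm) rho u t)"
    proof -
      have "integral ?S (\<lambda>x. d / 2) = d / 2 * (L ^ CARD('n) * (2 * real n))"
        unfolding slab_def using measure_cell[OF L, where ?'n = 'n] n
        by (simp add: content_Pair cell_def)
      moreover have "integral ?S (\<lambda>x. d / 2 + (rp - rm) / (rm * d) * along (kinetic rp rm) rho u t x)
          = integral ?S (\<lambda>x. d / 2) + integral ?S (\<lambda>x. (rp - rm) / (rm * d) * along (kinetic rp rm) rho u t x)"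
        by (rule integral_add[OF int1 int2])
      ultimately show ?thesis by simp
    qed
    also have "\<dots> \<le> d / 2 * (L ^ CARD('n) * (2 * real n)) + (rp - rm) / (rm * d) * ?E"
    proof -
      have "integral ?S (along (kinetic rp rm) rho u t) \<le> ?E"
        unfolding bulk_def using kin t kinetic_nonneg by (intro slab_integral_le L) auto
      thus ?thesis using d rm rp by (intro add_left_mono mult_left_mono) auto
    qed
    finally have *: "2 * real n * \<bar>W\<bar> \<le> d / 2 * (L ^ CARD('n) * (2 * real n)) + (rp - rm) / (rm * d) * ?E" .
    have "w \<le> d * (a / 2) + x / 2 * (1 / real n)" if "2 * real n * w \<le> d / 2 * (a * (2 * real n)) + x" for w a x
      using that n by (simp add: field_simps)
    from this[OF *] show ?thesis .
  qed
  have "\<bar>W\<bar> \<le> d * (L ^ CARD('n) / 2)" if d: "d > 0" for d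
  proof (rule LIMSEQ_le_const)
    show "(\<lambda>n. d * (L ^ CARD('n) / 2) + ((rp - rm) / (rm * d) * ?E / 2) * (1 / real n))
        \<longlonglongrightarrow> d * (L ^ CARD('n) / 2)"
      by (rule tendsto_eq_intros lim_1_over_n refl)+ simp
    show "\<exists>N. \<forall>n\<ge>N. \<bar>W\<bar> \<le> d * (L ^ CARD('n) / 2) + ((rp - rm) / (rm * d) * ?E / 2) * (1 / real n)"
      using le[OF d] by (intro exI[of _ 1]) auto
  qed
  hence "\<bar>W\<bar> \<le> 0 + e" if "e > 0" for e
  proof -
    have "L ^ CARD('n) > 0" using L by simp
    thus ?thesis using \<open>\<And>d. d > 0 \<Longrightarrow> \<bar>W\<bar> \<le> d * (L ^ CARD('n) / 2)\<close>[of "e / (L ^ CARD('n) / 2)"] that L by simp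
  qed
  hence "\<bar>W\<bar> \<le> 0" by (rule field_le_epsilon)
  thus ?thesis by (simp add: W)
qed

end

section \<open>Balance of kinetic and potential energy\<close>

lemma inner_e_z: "x \<bullet> e_z = snd x" "e_z \<bullet> x = snd x"
  by (simp_all add: e_z_def inner_prod_def)

context rayleigh_taylor
begin

text \<open>Diffusion of mass changes the kinetic energy density by half the squared speed times the
  Laplacian of the density. The term \<open>dir_deriv (grad (rho t) x) (u t) x\<close> of the
  momentum equation completes this to the divergence of half the squared speed times the density
  gradient, so diffusion has no net effect. Advection and pressure are divergences too, and only the
  power of gravity remains.\<close>

lemma kinetic_evolution:
  assumes t: "t > 0"
  shows "(\<lambda>n. integral (symmetric_slab n) (\<lambda>x. - (g / (rp - rm)) * (rho t x * snd (u t x))))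
      \<longlonglongrightarrow> L ^ CARD('n) * bulk_rate (kinetic rp rm) t"
proof -
  let ?r = "rho t" and ?D = "rp - rm"
  define a1 where "a1 x = (u t x \<bullet> u t x) / (2 * ?D)" for x
  define a1' where "a1' x h = (u t x \<bullet> Du t x h) / ?D" for x h
  define a2 where "a2 x = ?r x * ((u t x \<bullet> u t x) / (2 * ?D))" for x
  define a2' where "a2' x h = (grad ?r x \<bullet> h) * ((u t x \<bullet> u t x) / (2 * ?D)) + ?r x * ((u t x \<bullet> Du t x h) / ?D)" for x h
  have D: "?D > 0" using rp by simp
  have a1: "(a1 has_derivative a1' x) (at x)" for x
  proof -
    have "((\<lambda>x. u t x \<bullet> u t x) has_derivative (\<lambda>h. u t x \<bullet> Du t x h + Du t x h \<bullet> u t x)) (at x)"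
      by (intro has_derivative_inner u_derivative t)
    from bounded_linear.has_derivative[OF bounded_linear_divide this, of "2 * ?D"]
    show ?thesis unfolding a1_def[abs_def] a1'_def[abs_def]
      by (simp add: inner_commute del: right_diff_distrib_numeral)
  qed
  have a2: "(a2 has_derivative a2' x) (at x)" for x
    using has_derivative_mult[OF rho_derivative[OF t] a1[unfolded a1_def[abs_def] a1'_def[abs_def]]]
    unfolding a2_def[abs_def] a2'_def[abs_def] by (simp add: add.commute)
  have a1': "b \<in> Basis \<Longrightarrow> continuous_on UNIV (\<lambda>x. a1' x b)" for b
    unfolding a1'_def by (intro continuous_intros flux_continuous[OF t]) (use D in auto)
  have a2': "b \<in> Basis \<Longrightarrow> continuous_on UNIV (\<lambda>x. a2' x b)" for b
    unfolding a2'_def by (intro continuous_intros flux_continuous[OF t]) (use D in auto)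
  have a3': "continuous_on UNIV (\<lambda>x. grad (p t) x \<bullet> b)" for b
    by (intro continuous_intros flux_continuous[OF t])
  have per: "y_periodic L a1" "y_periodic L a2"
    using periodic[OF t] by (auto simp: y_periodic_def a1_def a2_def)
  have dr: "deriv (\<lambda>r. kinetic rp rm z r v) r = (v \<bullet> v) / (2 * ?D)" for z r and v :: "'n point"
    unfolding kinetic_def power2_norm_eq_inner using rp by (intro DERIV_imp_deriv) (auto intro!: derivative_eq_intros)
  have nb1: "no_boundary_term L (\<lambda>x. a1 x * snd (grad ?r x))"
    using regular(6)[OF _ t, of "kinetic rp rm"] by (simp add: dr a1_def)
  have "along (kinetic rp rm) rho u t = a2"
    by (simp add: fun_eq_iff along_def kinetic_def a2_def power2_norm_eq_inner)
  hence nb2: "no_boundary_term L (\<lambda>x. a2 x * snd (u t x))"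
    using regular(5)[OF _ t, of "kinetic rp rm"] by simp
  have nb3: "no_boundary_term L (\<lambda>x. p t x * snd (u t x))"
    using sol t unfolding classical_solution_def by blast
  note nb = nb1 nb2 nb3
  have dt: "deriv (\<lambda>s. along (kinetic rp rm) rho u s x) t =
     ((laplacian ?r x - u t x \<bullet> grad ?r x) * (u t x \<bullet> u t x) + 2 * (?r x * (u t x \<bullet> ut t x))) / (2 * ?D)" for x
  proof -
    have "((\<lambda>s. u s x \<bullet> u s x) has_real_derivative (2 * (u t x \<bullet> ut t x))) (at t)"
      using bounded_bilinear.has_vector_derivative[OF bounded_bilinear_inner
          u_time_derivative[OF t, of x] u_time_derivative[OF t, of x]]
      by (simp add: has_real_derivative_iff_has_vector_derivative inner_commute)
    from DERIV_cdivide[OF DERIV_mult[OF rho_time_derivative[OF t, of x] this], of "2 * ?D"]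
    show ?thesis unfolding along_def kinetic_def power2_norm_eq_inner
      by (intro DERIV_imp_deriv) (simp add: algebra_simps)
  qed
  have mom: "?r x * (u t x \<bullet> ut t x) = - ?r x * (u t x \<bullet> Du t x (u t x)) + u t x \<bullet> Du t x (grad ?r x)
      - grad (p t) x \<bullet> u t x - ?r x * g * snd (u t x)" for x
  proof -
    have "?r x * (u t x \<bullet> ut t x) = u t x \<bullet> (?r x *\<^sub>R ut t x)" by simp
    also have "\<dots> = - ?r x * (u t x \<bullet> Du t x (u t x)) + u t x \<bullet> Du t x (grad ?r x)
      - grad (p t) x \<bullet> u t x - ?r x * g * snd (u t x)"
      unfolding momentum[OF t] by (simp add: inner_diff_right inner_add_right inner_commute inner_e_z)
    finally show ?thesis .
  qed
  let ?B2 = "\<lambda>x. a2 x * (\<Sum>b\<in>Basis. Du t x b \<bullet> b) + a2' x (u t x)"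
  let ?B3 = "\<lambda>x. p t x * (\<Sum>b\<in>Basis. Du t x b \<bullet> b) + grad (p t) x \<bullet> u t x"
  have cont: "continuous_on UNIV ?B2" "continuous_on UNIV ?B3"
    using t by (auto intro!: flux_integrand_continuous a2 a2' a3' flux_rules flux_continuous)
  have lim: "(\<lambda>n. integral (symmetric_slab n) ?B2) \<longlonglongrightarrow> 0" "(\<lambda>n. integral (symmetric_slab n) ?B3) \<longlonglongrightarrow> 0"
    using t L by (auto intro!: flux_tendsto_zero a2 a2' a3' flux_rules flux_continuous per periodic nb)
  show ?thesis
  proof (rule bulk_rate_tendsto[OF _ t])
    show "- (g / ?D) * (?r x * snd (u t x)) = deriv (\<lambda>s. along (kinetic rp rm) rho u s x) t
        - (a1 x * (\<Sum>b\<in>Basis. hess t x b \<bullet> b) + a1' x (grad ?r x))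
        + (?B2 x + 1 / ?D * ?B3 x)" for x
    proof -
      define D where "D = rp - rm"
      have "D > 0" using rp by (simp add: D_def)
      thus ?thesis
        unfolding dt mom trace_hess[OF t] trace_Du[OF t] a1_def a1'_def a2'_def D_def[symmetric]
        by (simp add: field_simps inner_commute)
    qed
    show "continuous_on UNIV (\<lambda>x. ?B2 x + 1 / ?D * ?B3 x)"
      by (intro continuous_on_add continuous_on_mult continuous_on_const cont)
    have "integral (symmetric_slab n) (\<lambda>x. ?B2 x + 1 / ?D * ?B3 x)
        = integral (symmetric_slab n) ?B2 + 1 / ?D * integral (symmetric_slab n) ?B3" for n
      unfolding integral_add[OF continuous_integrable_on_slab[OF cont(1)]
          integrable_on_mult_right[OF continuous_integrable_on_slab[OF cont(2)]]] integral_mult_right ..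
    thus "(\<lambda>n. integral (symmetric_slab n) (\<lambda>x. ?B2 x + 1 / ?D * ?B3 x)) \<longlonglongrightarrow> 0"
      using tendsto_add[OF lim(1) tendsto_mult[OF tendsto_const lim(2)], of "1 / ?D"] by simp
  qed (use t L in \<open>auto intro!: flux_integrand_continuous flux_tendsto_zero a1 a1' flux_rules flux_continuous per periodic nb\<close>)
qed

text \<open>Integrating by parts against the weight \<open>snd x\<close> moves one derivative onto
  the height, which leaves the vertical diffusive and advective fluxes. The integration uses the
  smooth density \<open>c * (snd x * rho t x)\<close>, because the integrand of the potential energy
  involves the discontinuous reference density.\<close>

lemma potential_evolution:
  assumes t: "t > 0"
  shows "(\<lambda>n. integral (symmetric_slab n) (\<lambda>x. g / (rp - rm) * (snd (grad (rho t) x) - rho t x * snd (u t x))))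
      \<longlonglongrightarrow> L ^ CARD('n) * bulk_rate (potential g rp rm) t"
proof -
  let ?r = "rho t" and ?D = "rp - rm"
  define c where "c = g / ?D"
  define a1 where "a1 x = c * (snd x * ?r x)" for x
  define a1' where "a1' x h = c * (snd x * (grad ?r x \<bullet> h) + snd h * ?r x)" for x h
  define a2 where "a2 x = c * snd x" for x :: "'n point"
  define a2' where "a2' x h = c * snd h" for x h :: "'n point"
  have a1: "(a1 has_derivative a1' x) (at x)" for x
    unfolding a1_def[abs_def] a1'_def[abs_def]
    by (intro has_derivative_mult_right has_derivative_mult has_derivative_snd has_derivative_ident rho_derivative[OF t])
  have a2: "(a2 has_derivative a2' x) (at x)" for x
    unfolding a2_def[abs_def] a2'_def[abs_def]
    by (intro has_derivative_mult_right has_derivative_snd has_derivative_ident)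
  have a1': "continuous_on UNIV (\<lambda>x. a1' x b)" for b
    unfolding a1'_def by (intro continuous_intros flux_continuous[OF t])
  have a2': "continuous_on UNIV (\<lambda>x. a2' x b)" for b
    unfolding a2'_def by (intro continuous_intros)
  have per: "y_periodic L a1" "y_periodic L a2"
    using periodic[OF t] by (auto simp: y_periodic_def a1_def a2_def)
  have dr: "deriv (\<lambda>r. potential g rp rm z r v) r = - c * z" for z r and v :: "'n point"
    unfolding potential_def c_def using rp by (intro DERIV_imp_deriv) (auto intro!: derivative_eq_intros)
  have nb2: "no_boundary_term L (\<lambda>x. a2 x * snd (grad ?r x))"
    using no_boundary_term_cmult[OF regular(6)[OF _ t, of "potential g rp rm"], of "-1"]
    by (simp add: dr a2_def)
  \<comment> \<open>The assumed decay concerns the flux of the full potential density. Its reference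
    part is a function of the height times the vertical velocity, and has mean 0 over each
    section.\<close>
  have nb1: "no_boundary_term L (\<lambda>x. a1 x * snd (u t x))"
  proof -
    have "(LINT y:cell L|lborel. along (potential g rp rm) rho u t (y, z) * snd (u t (y, z)))
        = - (LINT y:cell L|lborel. a1 (y, z) * snd (u t (y, z)))" for z
    proof -
      have "continuous_on UNIV (\<lambda>x. snd (u t x))" "continuous_on UNIV (\<lambda>x. a1 x * snd (u t x))"
        unfolding a1_def by (intro continuous_intros flux_continuous[OF t])+
      note cont = this
      have "along (potential g rp rm) rho u t (y, z) * snd (u t (y, z))
          = ref_density rp rm z * c * z * snd (u t (y, z)) - a1 (y, z) * snd (u t (y, z))" for y
        by (simp add: along_def potential_def c_def a1_def diff_divide_distrib algebra_simps)
      hence "(LINT y:cell L|lborel. along (potential g rp rm) rho u t (y, z) * snd (u t (y, z)))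
          = ref_density rp rm z * c * z * (LINT y:cell L|lborel. snd (u t (y, z)))
            - (LINT y:cell L|lborel. a1 (y, z) * snd (u t (y, z)))"
        using set_integrable_cell[OF cont(1), where L = L] set_integrable_cell[OF cont(2), where L = L]
        by (simp add: set_integral_diff set_integrable_mult_right)
      thus ?thesis by (simp add: set_integral_cell[OF cont(1)] vertical_flux_zero[OF t])
    qed
    hence "(\<lambda>z. LINT y:cell L|lborel. a1 (y, z) * snd (u t (y, z)))
        = (\<lambda>z. - (LINT y:cell L|lborel. along (potential g rp rm) rho u t (y, z) * snd (u t (y, z))))"
      by auto
    thus ?thesis
      using regular(5)[OF _ t, of "potential g rp rm"] unfolding no_boundary_term_def
      by (auto dest: tendsto_minus)
  qed
  have dt: "deriv (\<lambda>s. along (potential g rp rm) rho u s x) t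
      = - c * snd x * (laplacian ?r x - u t x \<bullet> grad ?r x)" for x
  proof -
    have "((\<lambda>s. potential g rp rm (snd x) (rho s x) (u s x)) has_real_derivative
        (0 - (laplacian ?r x - u t x \<bullet> grad ?r x)) * g * snd x / ?D) (at t)"
      unfolding potential_def
      by (intro DERIV_cdivide DERIV_cmult_right DERIV_diff DERIV_const rho_time_derivative[OF t])
    moreover have "(0 - (a - b)) * g * z / ?D = - c * z * (a - b)" for a b z
      unfolding c_def by (simp add: algebra_simps diff_divide_distrib)
    ultimately show ?thesis unfolding along_def
      by (intro DERIV_imp_deriv) (simp only:)
  qed
  show ?thesis
  proof (rule bulk_rate_tendsto[OF _ t])
    show "g / ?D * (snd (grad ?r x) - ?r x * snd (u t x)) = deriv (\<lambda>s. along (potential g rp rm) rho u s x) t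
        - (a1 x * (\<Sum>b\<in>Basis. Du t x b \<bullet> b) + a1' x (u t x))
        + (a2 x * (\<Sum>b\<in>Basis. hess t x b \<bullet> b) + a2' x (grad ?r x))" for x
      unfolding dt trace_hess[OF t] trace_Du[OF t] a1'_def a2_def a2'_def c_def[symmetric]
      by (simp add: algebra_simps inner_commute)
  qed (use t L in \<open>auto intro!: flux_integrand_continuous flux_tendsto_zero a1 a2 a1' a2' flux_rules flux_continuous per periodic nb1 nb2\<close>)
qed

text \<open>The density converges only pointwise in \<open>y\<close>; its bound \<open>rp\<close> on
  a cell of finite volume gives dominated convergence.\<close>

lemma cell_integral_rho_tendsto:
  assumes t: "t > 0" and z: "\<And>y. (\<lambda>n. rho t (y, z n)) \<longlonglongrightarrow> r"
  shows "(\<lambda>n. integral (cell L) (\<lambda>y. rho t (y, z n))) \<longlonglongrightarrow> r * L ^ CARD('n)"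
proof -
  have fin: "emeasure lborel (cell L :: (real ^ 'n) set) < \<infinity>" using L by (simp add: emeasure_cell)
  have [measurable]: "(cell L :: (real ^ 'n) set) \<in> sets borel" by (simp add: cell_def)
  have meas: "(\<lambda>y. rho t (y, s)) \<in> borel_measurable borel" for s
    by (intro borel_measurable_continuous_onI continuous_on_compose2[OF rho_continuous[OF t]] continuous_intros) auto
  have "(\<lambda>n. LINT y:cell L|lborel. rho t (y, z n)) \<longlonglongrightarrow> (LINT (y :: real ^ 'n):cell L|lborel. r)"
    unfolding set_lebesgue_integral_def
  proof (rule integral_dominated_convergence[where w = "\<lambda>y. indicator (cell L) y * rp"])
    show "integrable lborel (\<lambda>y :: real ^ 'n. indicator (cell L) y * rp)"
      using fin by (intro integrable_mult_left integrable_real_indicator) auto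
    show "AE y in lborel. norm (indicator (cell L) y *\<^sub>R rho t (y, z n)) \<le> indicator (cell L) y * rp" for n
      using rho_bounds[OF t] rm by (auto simp: indicator_def abs_if intro!: AE_I2 less_imp_le) (smt (verit))
    show "AE y in lborel. (\<lambda>n. indicator (cell L) y *\<^sub>R rho t (y, z n)) \<longlonglongrightarrow> indicator (cell L) y *\<^sub>R r"
      by (intro AE_I2 tendsto_intros z)
  qed (use meas in auto)
  moreover have "(LINT (y :: real ^ 'n):cell L|lborel. r) = r * L ^ CARD('n)"
    using fin by (simp add: set_lebesgue_integral_def measure_cell[OF L])
  ultimately show ?thesis by (simp add: set_integral_cell[OF rho_continuous[OF t]])
qed

lemma slab_integral_grad_tendsto:
  assumes t: "t > 0"
  shows "(\<lambda>n. integral (symmetric_slab n) (\<lambda>x. snd (grad (rho t) x))) \<longlonglongrightarrow> (rp - rm) * L ^ CARD('n)"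
proof -
  have lim: "((\<lambda>z. rho t (y, z)) \<longlongrightarrow> rp) at_top" "((\<lambda>z. rho t (y, z)) \<longlongrightarrow> rm) at_bot" for y
    using sol t unfolding classical_solution_def by (simp, simp)
  have "integral (symmetric_slab n) (\<lambda>x. rho t x * (\<Sum>b\<in>Basis. (0 :: 'n point) \<bullet> b) + grad (rho t) x \<bullet> e_z)
    = integral (cell L) (\<lambda>y. rho t (y, real n) * snd (e_z :: 'n point)) - integral (cell L) (\<lambda>y. rho t (y, - real n) * snd (e_z :: 'n point))" for n
    by (rule slab_by_parts[where v = "\<lambda>_. e_z" and v' = "\<lambda>_ _. 0"])
       (use t L in \<open>auto intro!: rho_derivative continuous_intros flux_continuous periodic y_periodic_const\<close>)
  hence "integral (symmetric_slab n) (\<lambda>x. snd (grad (rho t) x))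
    = integral (cell L) (\<lambda>y. rho t (y, real n)) - integral (cell L) (\<lambda>y. rho t (y, - real n))" for n
    by (simp add: inner_e_z, simp add: e_z_def)
  moreover have "(\<lambda>n. integral (cell L) (\<lambda>y. rho t (y, real n)) - integral (cell L) (\<lambda>y. rho t (y, - real n)))
      \<longlonglongrightarrow> rp * L ^ CARD('n) - rm * L ^ CARD('n)"
    by (intro tendsto_diff cell_integral_rho_tendsto[OF t] filterlim_compose[OF lim(1)] filterlim_compose[OF lim(2)]
        filterlim_real_sequentially filterlim_compose[OF filterlim_uminus_at_bot_at_top filterlim_real_sequentially])
  ultimately show ?thesis by (simp add: left_diff_distrib)
qed

text \<open>The power of gravity enters both rates with the same sign. Their difference comes from
  the vertical derivative of the density, whose integral telescopes to the jump
  \<open>rp - rm\<close> and cancels the prefactor.\<close>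

lemma energy_balance:
  assumes t: "t > 0"
  shows "bulk_rate (potential g rp rm) t = g + bulk_rate (kinetic rp rm) t"
proof -
  have c: "continuous_on UNIV (\<lambda>x. snd (grad (rho t) x))" "continuous_on UNIV (\<lambda>x. rho t x * snd (u t x))"
    by (intro continuous_intros flux_continuous[OF t])+
  note i = continuous_integrable_on_slab[OF c(1)] continuous_integrable_on_slab[OF c(2)]
  have "integral (symmetric_slab n) (\<lambda>x. g / (rp - rm) * (snd (grad (rho t) x) - rho t x * snd (u t x)))
     = g / (rp - rm) * integral (symmetric_slab n) (\<lambda>x. snd (grad (rho t) x))
      + integral (symmetric_slab n) (\<lambda>x. - (g / (rp - rm)) * (rho t x * snd (u t x)))" for n
  proof -
    have "integral (symmetric_slab n) (\<lambda>x. g / (rp - rm) * (snd (grad (rho t) x) - rho t x * snd (u t x)))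
      = g / (rp - rm) * (integral (symmetric_slab n) (\<lambda>x. snd (grad (rho t) x))
        - integral (symmetric_slab n) (\<lambda>x. rho t x * snd (u t x)))"
      unfolding integral_mult_right integral_diff[OF i] ..
    moreover have "integral (symmetric_slab n) (\<lambda>x. - (g / (rp - rm)) * (rho t x * snd (u t x)))
      = - (g / (rp - rm)) * integral (symmetric_slab n) (\<lambda>x. rho t x * snd (u t x))"
      by (rule integral_mult_right)
    ultimately show ?thesis by (simp add: right_diff_distrib diff_divide_distrib)
  qed
  hence "(\<lambda>n. integral (symmetric_slab n) (\<lambda>x. g / (rp - rm) * (snd (grad (rho t) x) - rho t x * snd (u t x))))
      \<longlonglongrightarrow> g / (rp - rm) * ((rp - rm) * L ^ CARD('n)) + L ^ CARD('n) * bulk_rate (kinetic rp rm) t"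
    using tendsto_add[OF tendsto_mult[OF tendsto_const slab_integral_grad_tendsto[OF t]] kinetic_evolution[OF t], of "g / (rp - rm)"]
    by (simp only:)
  from tendsto_unique[OF _ potential_evolution[OF t] this]
  have "L ^ CARD('n) * bulk_rate (potential g rp rm) t
      = g / (rp - rm) * ((rp - rm) * L ^ CARD('n)) + L ^ CARD('n) * bulk_rate (kinetic rp rm) t" by simp
  also have "g / (rp - rm) * ((rp - rm) * L ^ CARD('n)) = L ^ CARD('n) * g" using rp by simp
  also have "\<dots> + L ^ CARD('n) * bulk_rate (kinetic rp rm) t = L ^ CARD('n) * (g + bulk_rate (kinetic rp rm) t)"
    by (rule distrib_left[symmetric])
  finally have "L ^ CARD('n) * bulk_rate (potential g rp rm) t = L ^ CARD('n) * (g + bulk_rate (kinetic rp rm) t)" .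
  thus ?thesis using L by simp
qed

end

section \<open>Growth bounds\<close>

context rayleigh_taylor
begin

lemma rho_closed_bounds: "t \<ge> 0 \<Longrightarrow> rm \<le> rho t x" "t \<ge> 0 \<Longrightarrow> rho t x \<le> rp"
proof -
  have "rho t x \<in> {rm..rp}" if "t \<ge> 0" using sol that unfolding classical_solution_def by blast
  thus "t \<ge> 0 \<Longrightarrow> rm \<le> rho t x" "t \<ge> 0 \<Longrightarrow> rho t x \<le> rp" by auto
qed

lemma potential_eq:
  "along (potential g rp rm) rho u t x
    = g * (snd x * ((if snd x \<ge> 0 then 1 else 0) - (rho t x - rm) / (rp - rm)))"
  using rp by (auto simp: along_def potential_def ref_density_def field_simps)

text \<open>
  Since horizontal averages of \<open>u \<bullet> e_z\<close> vanish, any function \<open>c\<close> of the height may be subtracted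
  from the density in \<open>\<integral>\<rho> (u \<bullet> e_z)\<close>; the parameters \<open>a\<close> and \<open>m\<close> linearize the Cauchy-Schwarz
  inequality and the bound in terms of the square root of the potential energy.
\<close>

lemma kinetic_rate_bound:
  assumes t: "t > 0" and a: "a > 0" and m: "m > 0"
  defines "K \<equiv> (rp - rm) ^ 3 / (6 * rp * rm)"
  shows "bulk_rate (kinetic rp rm) t
    \<le> g / (rp - rm) * (a * (rp - rm) * bulk L (kinetic rp rm) rho u t
        + 1 / (2 * a) * (m * (rp - rm) / g * bulk L (potential g rp rm) rho u t + K / m))"
proof -
  define D where "D = rp - rm"
  define c where "c z = atwood_centre rp rm (m * z)" for z
  define q where "q z = atwood_profile rp rm (m * z)" for z
  \<comment> \<open>\<open>J\<close> majorizes \<open>(rho - c)\<^sup>2 / rho\<close>, and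
    \<open>N\<close> majorizes the integrand of the power of gravity once \<open>c\<close> is
    subtracted. Both are integrable over the strip and nonnegative, so the bound is uniform over
    slabs.\<close>
  define J where "J x = m * D / g * along (potential g rp rm) rho u t x + 1 * q (snd x)" for x
  define N where "N x = a * D * along (kinetic rp rm) rho u t x + 1 / (2 * a) * J x" for x
  have D: "D > 0" using rp by (simp add: D_def)
  have K: "K \<ge> 0" using rp rm by (simp add: K_def)
  have c: "continuous_on UNIV c"
    unfolding c_def by (intro continuous_on_compose2[OF continuous_on_atwood_centre[OF rm rp, of UNIV]] continuous_intros) auto
  have chord: "(r - c z)\<^sup>2 / r \<le> m * z * ((if z \<ge> 0 then rp else rm) - r) + q z" if "rm \<le> r" "r \<le> rp" for r z
    using atwood_le_profile[OF rm rp that, of "m * z"] m by (simp add: c_def q_def zero_le_mult_iff)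
  \<comment> \<open>At the reference density the potential term of \<open>chord\<close> vanishes,
    and \<open>q z\<close> is bounded below by a square over a positive density.\<close>
  have q_nonneg: "q z \<ge> 0" for z
  proof -
    let ?r = "if z \<ge> 0 then rp else rm"
    have "0 \<le> (?r - c z)\<^sup>2 / ?r" using rp rm by simp
    also have "\<dots> \<le> q z" using chord[of ?r z] rp rm by simp
    finally show ?thesis .
  qed
  have J: "(rho t x - c (snd x))\<^sup>2 / rho t x \<le> J x" for x
  proof -
    have "m * D / g * along (potential g rp rm) rho u t x
        = m * snd x * ((if snd x \<ge> 0 then rp else rm) - rho t x)"
      using g D by (simp add: along_def potential_def ref_density_def flip: D_def)
    thus ?thesis unfolding J_def using chord[of "rho t x" "snd x"] rho_bounds[OF t, of x] by simp
  qed
  have qm: "q \<in> borel_measurable borel" unfolding q_def by measurable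
  have "(\<integral>\<^sup>+z. ennreal (q z) \<partial>lborel) \<le> ennreal (K / m)"
    unfolding q_def K_def by (intro nn_integral_scale atwood_profile_integral rm rp m) measurable
  note prof = strip_integral_profile[OF qm L _ q_nonneg this, where ?'n = 'n]
  have prof: "strip_integrable L (\<lambda>x :: 'n point. q (snd x))" "strip_integral L (\<lambda>x :: 'n point. q (snd x)) \<le> K / m"
    using prof K m by auto
  have pot: "strip_integrable L (along (potential g rp rm) rho u t)"
    and kin: "strip_integrable L (along (kinetic rp rm) rho u t)" using t by (auto intro!: regular)
  note Jint = strip_integral_linear[OF pot prof(1), of "m * D / g" 1, folded J_def]
  note Nint = strip_integral_linear[OF kin Jint(1), of "a * D" "1 / (2 * a)", folded N_def]
  have JJ: "J x \<ge> 0" for x using J[of x] rho_bounds[OF t, of x] by (smt (verit) divide_nonneg_pos zero_le_power2)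
  have N_nonneg: "N x \<ge> 0" for x
    unfolding N_def using JJ[of x] kinetic_nonneg[OF t, of x] a D by simp
  \<comment> \<open>Young's inequality with weight \<open>a * ?r\<close>: the squared velocity then
    carries the density, as in the kinetic energy, and the other square is divided by it.\<close>
  have young: "- ((rho t x - c (snd x)) * snd (u t x)) \<le> N x" for x
  proof -
    let ?r = "rho t x" and ?w = "snd (u t x)" and ?e = "rho t x - c (snd x)"
    have r: "?r > 0" using rho_bounds[OF t] by blast
    have "0 \<le> (a * ?r * ?w + ?e)\<^sup>2 / (2 * a * ?r)" using a r by simp
    also have "\<dots> = a * (?r * ?w\<^sup>2) / 2 + ?e * ?w + 1 / (2 * a) * (?e\<^sup>2 / ?r)"
      using a r by (simp add: field_simps power2_eq_square)
    finally have "- (?e * ?w) \<le> a * (?r * ?w\<^sup>2) / 2 + 1 / (2 * a) * (?e\<^sup>2 / ?r)" by simp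
    also have "\<dots> \<le> a * D * along (kinetic rp rm) rho u t x + 1 / (2 * a) * J x"
    proof (intro add_mono mult_left_mono J)
      have "?w\<^sup>2 \<le> (norm (u t x))\<^sup>2" by (cases "u t x") (simp add: norm_Pair)
      hence "a * (?r * ?w\<^sup>2) / 2 \<le> a * (?r * (norm (u t x))\<^sup>2) / 2"
        using a r by (intro divide_right_mono mult_left_mono) auto
      also have "\<dots> = a * D * along (kinetic rp rm) rho u t x"
        using D by (simp add: along_def kinetic_def flip: D_def)
      finally show "a * (?r * ?w\<^sup>2) / 2 \<le> a * D * along (kinetic rp rm) rho u t x" .
    qed (use a in auto)
    finally show ?thesis unfolding N_def .
  qed
  have "integral (symmetric_slab n) (\<lambda>x. - (g / D) * (rho t x * snd (u t x)))
      \<le> g / D * (L ^ CARD('n) * strip_integral L N)" for n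
  proof -
    have cont: "continuous_on UNIV (\<lambda>x. c (snd x) * snd (u t x))" "continuous_on UNIV (\<lambda>x. - ((rho t x - c (snd x)) * snd (u t x)))"
      by (intro continuous_intros continuous_on_compose2[OF c] flux_continuous[OF t]; simp)+
    note i = continuous_integrable_on_slab[OF cont(1)] continuous_integrable_on_slab[OF cont(2)]
    have "integral (symmetric_slab n) (\<lambda>x. c (snd x) * snd (u t x)) = 0"
      by (simp add: slab_integral_flux[OF t c] vertical_flux_zero[OF t])
    moreover have "- (rho t x * snd (u t x)) = - ((rho t x - c (snd x)) * snd (u t x)) - c (snd x) * snd (u t x)" for x
      by (simp add: algebra_simps)
    ultimately have "integral (symmetric_slab n) (\<lambda>x. - (rho t x * snd (u t x)))
        = integral (symmetric_slab n) (\<lambda>x. - ((rho t x - c (snd x)) * snd (u t x)))"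
      using integral_diff[OF i(2) i(1)] by simp
    also have "\<dots> \<le> integral (symmetric_slab n) N"
      by (intro integral_le i integrable_on_slab Nint young)
    also have "\<dots> \<le> L ^ CARD('n) * strip_integral L N"
      by (intro slab_integral_le Nint L N_nonneg)
    finally have "g / D * integral (symmetric_slab n) (\<lambda>x. - (rho t x * snd (u t x)))
        \<le> g / D * (L ^ CARD('n) * strip_integral L N)"
      using g D by (intro mult_left_mono) auto
    thus ?thesis by simp
  qed
  hence "L ^ CARD('n) * bulk_rate (kinetic rp rm) t \<le> g / D * (L ^ CARD('n) * strip_integral L N)"
    by (intro LIMSEQ_le_const2[OF kinetic_evolution[OF t, folded D_def]]) auto
  hence "L ^ CARD('n) * bulk_rate (kinetic rp rm) t \<le> L ^ CARD('n) * (g / D * strip_integral L N)"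
    by (simp only: mult.left_commute)
  hence "bulk_rate (kinetic rp rm) t \<le> g / D * strip_integral L N"
    using L by (subst (asm) mult_le_cancel_left_pos) auto
  also have "\<dots> \<le> g / D * (a * D * bulk L (kinetic rp rm) rho u t
        + 1 / (2 * a) * (m * D / g * bulk L (potential g rp rm) rho u t + K / m))"
    unfolding Nint(2) Jint(2) bulk_def using prof(2) a g D by (intro mult_left_mono add_left_mono) auto
  finally show ?thesis unfolding D_def .
qed

text \<open>In \<open>le\<close> the variable \<open>z\<close> is independent of the height of
  \<open>x\<close>, so the inequality may be used at \<open>l * snd x\<close>. This multiplies the
  potential term by \<open>l\<close> and divides the integral of the profile by \<open>l\<close>;
  optimizing \<open>l\<close> gives the square root.\<close>

lemma bulk_profile_bound:
  fixes e :: "'n bulk_fun" and q :: "real \<Rightarrow> real"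
  assumes t: "t \<ge> 0" and e: "e \<in> {potential g rp rm, kinetic rp rm, mixing rp rm, entropy rp rm}"
    and qm: "q \<in> borel_measurable borel" and nn: "\<And>z. q z \<ge> 0"
    and q: "(\<integral>\<^sup>+z. ennreal (q z) \<partial>lborel) \<le> ennreal K" and K: "K > 0"
    and le: "\<And>a z x. 0 \<le> a \<Longrightarrow> a \<le> 1 \<Longrightarrow> a = (rho t x - rm) / (rp - rm) \<Longrightarrow>
      along e rho u t x \<le> z * ((if z \<ge> 0 then 1 else 0) - a) + q z"
    and G: "bulk L (potential g rp rm) rho u t / g \<le> G" "G > 0"
  shows "bulk L e rho u t \<le> 2 * sqrt (K * G)"
proof (rule optimized_profile_bound[OF _ G K])
  fix l :: real assume l: "l > 0"
  have lqm: "(\<lambda>z. q (l * z)) \<in> borel_measurable borel" using qm by measurable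
  note prof = strip_integral_profile[OF lqm L _ nn nn_integral_scale[OF qm l q], where ?'n = 'n]
  have K': "K / l \<ge> 0" using K l by simp
  have pot: "strip_integrable L (along (potential g rp rm) rho u t)"
    and ei: "strip_integrable L (along e rho u t)" using t e by (auto intro!: regular)
  note lin = strip_integral_linear[OF pot prof(1)[OF K'], of "l / g" 1]
  have "strip_integral L (along e rho u t)
      \<le> strip_integral L (\<lambda>x. l / g * along (potential g rp rm) rho u t x + 1 * q (l * snd x))"
  proof (rule strip_integral_mono[OF ei lin(1) L])
    fix x
    define a where "a = (rho t x - rm) / (rp - rm)"
    have "0 \<le> a" "a \<le> 1" unfolding a_def using rho_closed_bounds[OF t, of x] rp by auto
    from le[OF this a_def, of "l * snd x"]
    have "along e rho u t x \<le> l * snd x * ((if l * snd x \<ge> 0 then 1 else 0) - a) + q (l * snd x)" .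
    moreover have "l / g * along (potential g rp rm) rho u t x = l * snd x * ((if l * snd x \<ge> 0 then 1 else 0) - a)"
      unfolding potential_eq a_def using g l by (simp add: zero_le_mult_iff)
    ultimately show "along e rho u t x \<le> l / g * along (potential g rp rm) rho u t x + 1 * q (l * snd x)" by simp
  qed
  also have "\<dots> \<le> l * (bulk L (potential g rp rm) rho u t / g) + K / l"
    unfolding lin(2) bulk_def using prof(2)[OF K'] by simp
  finally show "bulk L e rho u t \<le> l * (bulk L (potential g rp rm) rho u t / g) + K / l"
    unfolding bulk_def[of L e] .
qed

lemma mixing_bound:
  assumes "t \<ge> 0" "bulk L (potential g rp rm) rho u t / g \<le> G" "G > 0"
  shows "bulk L (mixing rp rm) rho u t \<le> 2 * sqrt (1 / 6 * G)"
proof (rule bulk_profile_bound[OF assms(1) _ _ _ mixing_profile_integral _ _ assms(2,3)])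
  fix a z and x :: "'n point" assume a: "0 \<le> a" "a \<le> 1" "a = (rho t x - rm) / (rp - rm)"
  have "along (mixing rp rm) rho u t x = a * (1 - a)"
    unfolding a(3) using rp by (simp add: along_def mixing_def field_simps power2_eq_square)
  thus "along (mixing rp rm) rho u t x \<le> z * ((if z \<ge> 0 then 1 else 0) - a) + (max 0 (1 - \<bar>z\<bar>))\<^sup>2 / 4"
    using mixing_le_profile[OF a(1,2), of z] by simp
qed auto

lemma entropy_bound:
  assumes "t \<ge> 0" "bulk L (potential g rp rm) rho u t / g \<le> G" "G > 0"
  shows "bulk L (entropy rp rm) rho u t \<le> 2 * sqrt (pi\<^sup>2 / 6 * G)"
proof (rule bulk_profile_bound[OF assms(1) _ _ _ entropy_profile_integral _ _ assms(2,3)])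
  fix a z and x :: "'n point" assume a: "0 \<le> a" "a \<le> 1" "a = (rho t x - rm) / (rp - rm)"
  have "(rp - rho t x) / (rp - rm) = 1 - a"
    unfolding a(3) using rp by (simp add: field_simps)
  hence "along (entropy rp rm) rho u t x = - (a * ln a + (1 - a) * ln (1 - a))"
    by (simp add: along_def entropy_def flip: a(3))
  thus "along (entropy rp rm) rho u t x \<le> z * ((if z \<ge> 0 then 1 else 0) - a) + ln (1 + exp (- \<bar>z\<bar>))"
    using entropy_le_profile[OF a(1,2), of z] by simp
qed auto

section \<open>Entropy dissipation and the mean perimeter\<close>

lemma mixing_nonneg: "t \<ge> 0 \<Longrightarrow> along (mixing rp rm) rho u t x \<ge> 0"
  using rho_closed_bounds[of t x] rp by (simp add: along_def mixing_def)

lemma entropy_nonneg: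
  assumes "t \<ge> 0"
  shows "along (entropy rp rm) rho u t x \<ge> 0"
proof -
  have l: "a * ln a \<le> 0" if "0 \<le> a" "a \<le> 1" for a :: real
    using that by (cases "a = 0") (auto simp: mult_le_0_iff)
  show ?thesis
    using l[of "(rp - rho t x) / (rp - rm)"] l[of "(rho t x - rm) / (rp - rm)"] rho_closed_bounds[OF assms, of x] rp
    unfolding along_def entropy_def by (auto simp: divide_le_eq_1)
qed

lemma bulk_nonneg:
  assumes "\<And>x. along e rho u t x \<ge> 0"
  shows "bulk L e rho u t \<ge> 0"
  unfolding bulk_def strip_integral_def set_lebesgue_integral_def
  using assms L by (intro mult_nonneg_nonneg integral_nonneg) auto

lemma dissipation_continuous: "t > 0 \<Longrightarrow> continuous_on UNIV (dissipation t)"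
  using rho_bounds[of t] by (intro continuous_intros flux_continuous) (auto simp: less_imp_neq[symmetric] dest: less_imp_neq)

lemma dissipation_nonneg: "t > 0 \<Longrightarrow> dissipation t x \<ge> 0"
  using rho_bounds[of t x] by simp

lemma dissipation_slab_le:
  assumes t: "t > 0"
  shows "integral (symmetric_slab n) (dissipation t) \<le> L ^ CARD('n) * bulk_rate (entropy rp rm) t"
proof (rule incseq_le[OF _ entropy_production[OF t]])
  show "incseq (\<lambda>n. integral (symmetric_slab n) (dissipation t))"
    using slab_mono dissipation_continuous[OF t] dissipation_nonneg[OF t]
    by (auto simp: incseq_def intro!: integral_subset_le continuous_integrable_on_slab)
qed

lemma entropy_rate_nonneg:
  assumes t: "t > 0"
  shows "bulk_rate (entropy rp rm) t \<ge> 0"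
proof -
  have "0 \<le> integral (symmetric_slab 0) (dissipation t)"
    using dissipation_continuous[OF t] dissipation_nonneg[OF t]
    by (intro Henstock_Kurzweil_Integration.integral_nonneg continuous_integrable_on_slab) auto
  also have "\<dots> \<le> L ^ CARD('n) * bulk_rate (entropy rp rm) t" by (rule dissipation_slab_le[OF t])
  finally show ?thesis using zero_less_power[OF L, of "CARD('n)"] by (simp add: zero_le_mult_iff)
qed

text \<open>The weights of \<open>dissipation\<close> and \<open>mixing\<close> are reciprocal up to
  \<open>(rp - rm)\<^sup>2\<close>, so the norm of the gradient is \<open>rp - rm\<close> times the
  geometric mean of the two densities. Its arithmetic-mean bound with weight \<open>b\<close> is
  integrated over slabs, which yields finiteness; varying \<open>b\<close> restores the
  product.\<close>

lemma perimeter_squared_le: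
  assumes t: "t > 0"
  shows "(mean_perimeter L rp rm rho t)\<^sup>2 \<le> ennreal (bulk_rate (entropy rp rm) t * bulk L (mixing rp rm) rho u t)"
proof -
  let ?s = "bulk_rate (entropy rp rm) t" and ?h = "bulk L (mixing rp rm) rho u t" and ?c = "(rp - rm) * L ^ CARD('n)"
  define I where "I = (\<integral>\<^sup>+x\<in>strip L. ennreal (norm (grad (rho t) x)) \<partial>lborel)"
  have c: "?c > 0" using rp L by simp
  have mix: "strip_integrable L (along (mixing rp rm) rho u t)" using t by (auto intro!: regular)
  have h: "?h \<ge> 0" using mixing_nonneg t by (intro bulk_nonneg) auto
  have s: "?s \<ge> 0" by (rule entropy_rate_nonneg[OF t])
  have le: "I \<le> ennreal (?c * ((b * ?s + ?h / b) / 2))" if b: "b > 0" for b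
    unfolding I_def
  proof (rule nn_integral_strip_le)
    show "continuous_on UNIV (\<lambda>x. norm (grad (rho t) x))"
      by (intro continuous_intros flux_continuous[OF t])
    fix n
    let ?S = "symmetric_slab n :: 'n point set"
    let ?k = "(rp - rm) / 2 * b" and ?l = "(rp - rm) / (2 * b)"
    have i: "dissipation t integrable_on ?S" "along (mixing rp rm) rho u t integrable_on ?S"
      by (rule continuous_integrable_on_slab[OF dissipation_continuous[OF t]], rule integrable_on_slab[OF mix])
    have "norm (grad (rho t) x) \<le> ?k * dissipation t x + ?l * along (mixing rp rm) rho u t x" for x
    proof -
      let ?n = "norm (grad (rho t) x)" and ?q = "(rp - rho t x) * (rho t x - rm)"
      have q: "?q > 0" using rho_bounds[OF t, of x] by simp
      define D where "D = rp - rm"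
      have D: "D > 0" using rp by (simp add: D_def)
      have square: "(b * D * n - q)\<^sup>2 / (2 * b * D * q) = D / 2 * b * (n\<^sup>2 / q) + D / (2 * b) * (q / D\<^sup>2) - n"
        if "q > 0" for n q using b D that by (simp add: field_simps power2_eq_square)
      have "0 \<le> (b * D * ?n - ?q)\<^sup>2 / (2 * b * D * ?q)" using b D q by simp
      also note square[OF q]
      finally show ?thesis by (simp add: along_def mixing_def flip: D_def)
    qed
    hence "integral ?S (\<lambda>x. norm (grad (rho t) x)) \<le> integral ?S (\<lambda>x. ?k * dissipation t x + ?l * along (mixing rp rm) rho u t x)"
      by (intro integral_le integrable_add integrable_on_mult_right i continuous_integrable_on_slab
          continuous_intros flux_continuous[OF t])
    also have "\<dots> = ?k * integral ?S (dissipation t) + ?l * integral ?S (along (mixing rp rm) rho u t)"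
      using i by (subst integral_add) (auto intro!: integrable_on_mult_right simp del: times_divide_eq_left times_divide_eq_right)
    also have "\<dots> \<le> ?k * (L ^ CARD('n) * ?s) + ?l * (L ^ CARD('n) * ?h)"
      unfolding bulk_def using b rp t
      by (intro add_mono mult_left_mono dissipation_slab_le slab_integral_le mix L mixing_nonneg) auto
    also have "\<dots> = ?c * ((b * ?s + ?h / b) / 2)" using b by (simp add: field_simps)
    finally show "integral ?S (\<lambda>x. norm (grad (rho t) x)) \<le> ?c * ((b * ?s + ?h / b) / 2)" .
  qed auto
  have "I < \<infinity>" using le[of 1] by (auto intro: le_less_trans)
  then obtain P where P: "P \<ge> 0" "I = ennreal P" by (cases I) auto
  have "P / ?c \<le> (b * ?s + ?h / b) / 2" if b: "b > 0" for b
  proof -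
    have "P \<le> ?c * ((b * ?s + ?h / b) / 2)"
      using le[OF b] c b s h unfolding P(2) by (subst (asm) ennreal_le_iff) auto
    thus ?thesis using c by (simp add: divide_le_eq mult.commute)
  qed
  hence "(P / ?c)\<^sup>2 \<le> ?s * ?h"
    using P c s h by (intro square_le_prod_if_AM_GM) auto
  moreover have "mean_perimeter L rp rm rho t = ennreal (P / ?c)"
    unfolding mean_perimeter_def I_def[symmetric] P(2) using c P by (simp add: divide_ennreal)
  ultimately show ?thesis using c P by (simp add: ennreal_power ennreal_leI)
qed

section \<open>Growth of the energies and of the time-integrated perimeter\<close>

lemma energy_identity:
  assumes "t \<ge> 0"
  shows "bulk L (potential g rp rm) rho u t = bulk L (kinetic rp rm) rho u t + g * t
    + (bulk L (potential g rp rm) rho u 0 - bulk L (kinetic rp rm) rho u 0)"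
proof (cases "t = 0")
  case False
  let ?f = "\<lambda>t. bulk L (potential g rp rm) rho u t - bulk L (kinetic rp rm) rho u t - g * t"
  have "?f t = ?f 0"
  proof (rule DERIV_isconst2[of 0 t])
    show "continuous_on {0..t} ?f"
      by (intro continuous_intros continuous_on_subset[OF regular(2)]) auto
    fix s assume s: "0 < s" "s < t"
    have "(?f has_real_derivative bulk_rate (potential g rp rm) s - bulk_rate (kinetic rp rm) s - g) (at s)"
      using s by (auto intro!: derivative_eq_intros regular(4))
    thus "(?f has_real_derivative 0) (at s)" using energy_balance[OF s(1)] by simp
  qed (use assms False in auto)
  thus ?thesis by simp
qed simp

lemma potential_growth:
  assumes k: "k \<ge> 0" "k ^ 4 = g\<^sup>2 * (rp - rm)\<^sup>2 / (96 * rp * rm)"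
  obtains b where "b > 0" "\<And>t. t \<ge> 0 \<Longrightarrow> bulk L (potential g rp rm) rho u t / g \<le> (k * t + t powr (1/4) + b) ^ 4"
proof -
  let ?Ep = "bulk L (potential g rp rm) rho u" and ?Ek = "bulk L (kinetic rp rm) rho u"
  define c where "c = ?Ep 0 / g - ?Ek 0 / g"
  \<comment> \<open>The constant \<open>\<bar>c\<bar> + 1\<close> makes \<open>F\<close> dominate
    both energies divided by \<open>g\<close> while keeping \<open>F t \<ge> 1 + t\<close>. One
    function thus replaces both energies in the differential inequality.\<close>
  define F where "F t = ?Ek t / g + t + (\<bar>c\<bar> + 1)" for t
  have Ep: "?Ep t / g = ?Ek t / g + t + c" if "t \<ge> 0" for t
    unfolding c_def using g by (subst energy_identity[OF that]) (simp add: add_divide_distrib diff_divide_distrib)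
  have Ek0: "?Ek t \<ge> 0" if "t \<ge> 0" for t
  proof (rule bulk_nonneg)
    fix x
    have "rho t x \<ge> 0" using rho_closed_bounds(1)[OF that, of x] rm by simp
    thus "along (kinetic rp rm) rho u t x \<ge> 0" using rp by (simp add: along_def kinetic_def)
  qed
  have Ek: "?Ek t / g \<ge> 0" if "t \<ge> 0" for t using Ek0[OF that] g by simp
  have lower: "F t \<ge> 1 + t" if "t \<ge> 0" for t using Ek[OF that] by (simp add: F_def)
  have FEk: "?Ek t / g \<le> F t" "?Ep t / g \<le> F t" if "t \<ge> 0" for t using Ep[OF that] that by (auto simp: F_def)
  let ?K = "(rp - rm)\<^sup>2 / (6 * rp * rm)"
  have "F t \<le> (k * t + t powr (1/4) + F 0 powr (1/4)) ^ 4" if "t \<ge> 0" for t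
  proof (rule quarter_power_growth[OF _ _ lower _ that])
    show "continuous_on {0..} F"
      unfolding F_def by (intro continuous_intros regular(2)) (use g in auto)
    fix s :: real assume s: "s > 0"
    show "(F has_real_derivative bulk_rate (kinetic rp rm) s / g + 1) (at s)"
      unfolding F_def[abs_def] using s g by (auto intro!: derivative_eq_intros regular(4))
    have "bulk_rate (kinetic rp rm) s / g \<le> 4 * k * F s powr (3/4)"
    proof (rule optimized_growth_rate)
      fix a m :: real assume am: "a > 0" "m > 0"
      have D: "rp - rm > 0" using rp by simp
      have "bulk_rate (kinetic rp rm) s / g \<le> (g / (rp - rm) * (a * (rp - rm) * ?Ek s
        + 1 / (2 * a) * (m * (rp - rm) / g * ?Ep s + (rp - rm) ^ 3 / (6 * rp * rm) / m))) / g"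
        using kinetic_rate_bound[OF s am] g by (intro divide_right_mono) auto
      also have "\<dots> = a * g * (?Ek s / g) + (m * (?Ep s / g) + ?K / m) / (2 * a)"
      proof -
        have "g / d * (a * d * x + 1 / (2 * a) * (m * d / g * y + d ^ 3 / c / m)) / g
            = a * g * (x / g) + (m * (y / g) + d\<^sup>2 / c / m) / (2 * a)" if "d > 0" "c > 0" for d c x y
        proof -
          have "g / d * (a * d * x + 1 / (2 * a) * (m * d / g * y + d ^ 3 / c / m)) / g
            = (a * d * x + 1 / (2 * a) * (m * d / g * y + d ^ 3 / c / m)) / d" using g by simp
          also have "\<dots> = a * x + (m * (y / g) + d\<^sup>2 / c / m) / (2 * a)"
            using that am by (simp add: add_divide_distrib power2_eq_square power3_eq_cube)
          finally show ?thesis using g by simp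
        qed
        thus ?thesis using rp rm by simp
      qed
      also have "\<dots> \<le> a * g * F s + (m * F s + ?K / m) / (2 * a)"
        using FEk[of s] s am g rm rp by (intro add_mono mult_left_mono divide_right_mono) auto
      finally show "bulk_rate (kinetic rp rm) s / g \<le> a * g * F s + (m * F s + ?K / m) / (2 * a)" .
    qed (use lower[of s] s g rp rm k in auto)
    thus "bulk_rate (kinetic rp rm) s / g + 1 \<le> 1 + 4 * k * F s powr (3/4)" by simp
  qed
  moreover have "F 0 powr (1/4) > 0" using lower[of 0] by simp
  ultimately show thesis using that[of "F 0 powr (1/4)"] FEk(2) by (meson order_trans)
qed

text \<open>Bounding \<open>H\<close> by a constant \<open>h\<close> on the whole interval leaves
  the integral of the entropy rate, which telescopes; the initial entropy is nonnegative and is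
  dropped. Since the entropy is only continuous at time 0, the fundamental theorem is applied with
  derivatives at interior times.\<close>

lemma perimeter_integral_le:
  assumes t: "t \<ge> 0" and h: "h \<ge> 0" "\<And>s. 0 < s \<Longrightarrow> s < t \<Longrightarrow> bulk L (mixing rp rm) rho u s \<le> h"
  shows "(\<integral>\<^sup>+s\<in>{0..t}. (mean_perimeter L rp rm rho s)\<^sup>2 \<partial>lborel)
    \<le> ennreal (h * bulk L (entropy rp rm) rho u t)"
proof -
  let ?S = "bulk L (entropy rp rm) rho u" and ?S' = "bulk_rate (entropy rp rm)"
  have "(?S' has_integral (?S t - ?S 0)) {0..t}"
  proof (rule fundamental_theorem_of_calculus_interior[OF t])
    show "continuous_on {0..t} ?S" by (rule continuous_on_subset[OF regular(2)]) auto
    show "(?S has_vector_derivative ?S' s) (at s)" if "s \<in> {0<..<t}" for s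
      using that regular(4)[of "entropy rp rm" s] by (simp add: has_real_derivative_iff_has_vector_derivative)
  qed
  hence "((\<lambda>s. h * ?S' s) has_integral (h * (?S t - ?S 0))) {0<..<t}"
    by (intro has_integral_mult_right) (simp add: has_integral_Icc_iff_Ioo)
  hence "(\<integral>\<^sup>+s. ennreal (h * ?S' s) * indicator {0<..<t} s \<partial>lborel) = ennreal (h * (?S t - ?S 0))"
    using h entropy_rate_nonneg by (intro nn_integral_has_integral_lebesgue') auto
  moreover have "(\<integral>\<^sup>+s\<in>{0..t}. (mean_perimeter L rp rm rho s)\<^sup>2 \<partial>lborel)
      \<le> (\<integral>\<^sup>+s. ennreal (h * ?S' s) * indicator {0<..<t} s \<partial>lborel)"
  proof (rule nn_integral_mono_AE)
    have "AE s in lborel. s \<noteq> 0 \<and> s \<noteq> t"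
      using AE_lborel_singleton[of 0] AE_lborel_singleton[of t] by eventually_elim auto
    thus "AE s in lborel. (mean_perimeter L rp rm rho s)\<^sup>2 * indicator {0..t} s
        \<le> ennreal (h * ?S' s) * indicator {0<..<t} s"
    proof eventually_elim
      case (elim s)
      show ?case
      proof (cases "s \<in> {0<..<t}")
        case True
        have "(mean_perimeter L rp rm rho s)\<^sup>2 \<le> ennreal (?S' s * bulk L (mixing rp rm) rho u s)"
          using True by (intro perimeter_squared_le) auto
        also have "\<dots> \<le> ennreal (h * ?S' s)"
          using mult_left_mono[OF h(2), of s "?S' s"] entropy_rate_nonneg[of s] True
          by (intro ennreal_leI) (simp add: mult.commute)
        finally show ?thesis using True by (simp add: indicator_def)
      qed (use elim in \<open>auto simp: indicator_def\<close>)
    qed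
  qed
  ultimately have "(\<integral>\<^sup>+s\<in>{0..t}. (mean_perimeter L rp rm rho s)\<^sup>2 \<partial>lborel) \<le> ennreal (h * (?S t - ?S 0))"
    by simp
  also have "\<dots> \<le> ennreal (h * ?S t)"
    using h bulk_nonneg[OF entropy_nonneg, of 0] by (intro ennreal_leI mult_left_mono) auto
  finally show ?thesis .
qed

end

section \<open>The three asymptotic bounds\<close>

theorem theorem1:
  fixes L g rp rm A :: real
    and rho :: "real \<Rightarrow> 'n::finite point \<Rightarrow> real"
    and u :: "real \<Rightarrow> 'n point \<Rightarrow> 'n point"
    and p :: "real \<Rightarrow> 'n point \<Rightarrow> real"
  assumes "L > 0" and "g > 0" and "rm > 0" and "rp > rm"
    and "A = (rp - rm) / (rp + rm)"
    and "classical_solution L g rp rm rho u p"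
    and "strip_integrable L (along (potential g rp rm) rho u 0)"
    and "strip_integrable L (along (mixing rp rm) rho u 0)"
    and "initial_mean_perimeter L rp rm (rho 0) < \<infinity>"
  shows "Limsup at_top (\<lambda>t. ereal (bulk L (potential g rp rm) rho u t / (g * (A * g * t\<^sup>2)\<^sup>2)))
           \<le> ereal (1 / (24 * (1 - A\<^sup>2)))
       \<and> Limsup at_top (\<lambda>t. ereal (bulk L (mixing rp rm) rho u t / (A * g * t\<^sup>2)))
           \<le> ereal (1 / (6 * sqrt (1 - A\<^sup>2)))
       \<and> Limsup at_top (\<lambda>t. (\<integral>\<^sup>+\<tau>\<in>{0..t}. (mean_perimeter L rp rm rho \<tau>)\<^sup>2 \<partial>lborel)
                              / ennreal ((A * g * t\<^sup>2)\<^sup>2))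
           \<le> ennreal (pi / (36 * (1 - A\<^sup>2)))"
proof -
  interpret rayleigh_taylor L g rp rm rho u p
    using assms by unfold_locales
  note A = assms(5)
  define l where "l = 1 / (24 * (1 - A\<^sup>2))"
  have A2: "1 - A\<^sup>2 = 4 * rp * rm / (rp + rm)\<^sup>2"
  proof -
    have "(rp + rm)\<^sup>2 \<noteq> 0" using rp rm by simp
    hence "1 - A\<^sup>2 = ((rp + rm)\<^sup>2 - (rp - rm)\<^sup>2) / (rp + rm)\<^sup>2"
      unfolding A power_divide by (simp add: diff_divide_distrib)
    also have "(rp + rm)\<^sup>2 - (rp - rm)\<^sup>2 = 4 * rp * rm"
      by (simp add: power2_eq_square algebra_simps)
    finally show ?thesis .
  qed
  have A_pos: "A > 0" and A2_pos: "1 - A\<^sup>2 > 0" unfolding A2 using rp rm by (auto simp: A)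
  have l: "l > 0" using A2_pos by (simp add: l_def)
  \<comment> \<open>An upper rate for the fourth root of the potential energy over \<open>g\<close>.
    The 96 is the 6 of the profile integral times the 16 of
    \<open>optimized_growth_rate\<close>.\<close>
  define k where "k = root 4 (g\<^sup>2 * (rp - rm)\<^sup>2 / (96 * rp * rm))"
  have k: "k \<ge> 0" "k ^ 4 = g\<^sup>2 * (rp - rm)\<^sup>2 / (96 * rp * rm)"
    unfolding k_def using rp rm by auto
  have kl: "k ^ 4 / (A * g)\<^sup>2 = l"
  proof -
    have "rp - rm > 0" using rp by simp
    thus ?thesis unfolding k(2) l_def A2 using rp rm g
      by (simp add: A power_mult_distrib power_divide field_simps) (simp add: power2_eq_square algebra_simps)
  qed
  obtain b where b: "b > 0"
    and Ep: "\<And>t. t \<ge> 0 \<Longrightarrow> bulk L (potential g rp rm) rho u t / g \<le> (k * t + t powr (1/4) + b) ^ 4"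
    using potential_growth[OF k] by blast
  define B where "B t = (k * t + t powr (1/4) + b) ^ 4" for t
  define X where "X t = A * g * t\<^sup>2" for t
  have X: "X t > 0" if "t > 0" for t unfolding X_def using that A_pos g by simp
  have B_pos: "B t > 0" if "t \<ge> 0" for t unfolding B_def using that k b by (intro zero_less_power add_nonneg_pos add_nonneg_nonneg) auto
  \<comment> \<open>Lets the value at the final time bound \<open>H\<close> at all earlier times in
    the perimeter estimate.\<close>
  have B_mono: "B s \<le> B t" if "0 \<le> s" "s \<le> t" for s t
    unfolding B_def using that k b by (intro power_mono add_mono mult_left_mono powr_mono2) auto
  \<comment> \<open>With \<open>t\<close> factored out of the fourth root, \<open>t ^ 4\<close>
    cancels against \<open>(X t)\<^sup>2\<close> and the corrections to \<open>k\<close> tend to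
    0.\<close>
  have "((\<lambda>t. (k + t powr (-3/4) + b / t) ^ 4 / (A * g)\<^sup>2) \<longlongrightarrow> (k + 0 + 0) ^ 4 / (A * g)\<^sup>2) at_top"
  proof (intro tendsto_intros)
    show "((\<lambda>t :: real. t powr (-3/4)) \<longlongrightarrow> 0) at_top" "((\<lambda>t :: real. b / t) \<longlongrightarrow> 0) at_top" by real_asymp+
  qed (use A_pos g in auto)
  moreover have "\<forall>\<^sub>F t in at_top. (k + t powr (-3/4) + b / t) ^ 4 / (A * g)\<^sup>2 = B t / (X t)\<^sup>2"
    using eventually_gt_at_top[of 0]
  proof eventually_elim
    case (elim t)
    have "t powr (1/4) = t * t powr (-3/4)" using elim powr_mult_base[of t "-3/4"] by simp
    hence "k * t + t powr (1/4) + b = t * (k + t powr (-3/4) + b / t)" using elim by (simp add: algebra_simps)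
    hence "B t / (X t)\<^sup>2 = (t ^ 4 * (k + t powr (-3/4) + b / t) ^ 4) / (t ^ 4 * (A * g)\<^sup>2)"
      unfolding B_def X_def by (simp add: power_mult_distrib mult_ac flip: power_mult)
    thus ?case using elim by simp
  qed
  ultimately have lim: "((\<lambda>t. B t / (X t)\<^sup>2) \<longlongrightarrow> l) at_top"
    using kl by (simp add: tendsto_cong)
  have pos: "\<forall>\<^sub>F t in at_top. (t :: real) > 0" by (rule eventually_gt_at_top)

  have "Limsup at_top (\<lambda>t. ereal (bulk L (potential g rp rm) rho u t / (g * (X t)\<^sup>2))) \<le> ereal l"
  proof -
    have "Limsup at_top (\<lambda>t. ereal (bulk L (potential g rp rm) rho u t / (g * (X t)\<^sup>2)))
        \<le> Limsup at_top (\<lambda>t. ereal (B t / (X t)\<^sup>2))"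
    proof (rule Limsup_mono, use pos in eventually_elim)
      case (elim t)
      have "bulk L (potential g rp rm) rho u t / g / (X t)\<^sup>2 \<le> B t / (X t)\<^sup>2"
        using Ep[of t] elim unfolding B_def by (intro divide_right_mono) auto
      thus ?case by simp
    qed
    also have "\<dots> = ereal l"
      using lim by (intro lim_imp_Limsup) (auto simp: tendsto_ereal)
    finally show ?thesis .
  qed
  moreover have "Limsup at_top (\<lambda>t. ereal (bulk L (mixing rp rm) rho u t / X t)) \<le> ereal (1 / (6 * sqrt (1 - A\<^sup>2)))"
  proof -
    have "Limsup at_top (\<lambda>t. ereal (bulk L (mixing rp rm) rho u t / X t))
        \<le> Limsup at_top (\<lambda>t. ereal (2 * sqrt (1 / 6 * (B t / (X t)\<^sup>2))))"
    proof (rule Limsup_mono, use pos in eventually_elim)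
      case (elim t)
      have "bulk L (mixing rp rm) rho u t / X t \<le> 2 * sqrt (1 / 6 * B t) / X t"
        using elim X[of t] B_pos[of t] Ep[of t] unfolding B_def
        by (intro divide_right_mono mixing_bound) auto
      also have "\<dots> = 2 * sqrt (1 / 6 * (B t / (X t)\<^sup>2))"
        using X[OF elim] real_sqrt_divide[of "1 / 6 * B t" "(X t)\<^sup>2"] by simp
      finally show ?case by simp
    qed
    also have "\<dots> = ereal (2 * sqrt (1 / 6 * l))"
      using lim by (intro lim_imp_Limsup tendsto_ereal tendsto_intros) auto
    also have "2 * sqrt (1 / 6 * l) = 1 / (6 * sqrt (1 - A\<^sup>2))"
    proof -
      have "1 / 6 * l = 1 / (12\<^sup>2 * (1 - A\<^sup>2))" by (simp add: l_def)
      also have "sqrt \<dots> = 1 / (12 * sqrt (1 - A\<^sup>2))"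
        unfolding real_sqrt_divide real_sqrt_mult by simp
      finally show ?thesis by simp
    qed
    finally show ?thesis .
  qed
  moreover have "Limsup at_top (\<lambda>t. (\<integral>\<^sup>+\<tau>\<in>{0..t}. (mean_perimeter L rp rm rho \<tau>)\<^sup>2 \<partial>lborel) / ennreal ((X t)\<^sup>2))
      \<le> ennreal (pi / (36 * (1 - A\<^sup>2)))"
  proof -
    have "Limsup at_top (\<lambda>t. (\<integral>\<^sup>+\<tau>\<in>{0..t}. (mean_perimeter L rp rm rho \<tau>)\<^sup>2 \<partial>lborel) / ennreal ((X t)\<^sup>2))
        \<le> Limsup at_top (\<lambda>t. ennreal (2 * pi / 3 * (B t / (X t)\<^sup>2)))"
    proof (rule Limsup_mono, use pos in eventually_elim)
      case (elim t)
      let ?h = "2 * sqrt (1 / 6 * B t)"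
      have "bulk L (mixing rp rm) rho u s \<le> ?h" if "0 < s" "s < t" for s
        using that B_pos[of t] order_trans[OF Ep[of s] B_mono[of s t, unfolded B_def[of s]]]
        by (intro mixing_bound) auto
      hence "(\<integral>\<^sup>+\<tau>\<in>{0..t}. (mean_perimeter L rp rm rho \<tau>)\<^sup>2 \<partial>lborel)
          \<le> ennreal (?h * bulk L (entropy rp rm) rho u t)"
        using elim B_pos[of t] by (intro perimeter_integral_le) auto
      also have "\<dots> \<le> ennreal (?h * (2 * sqrt (pi\<^sup>2 / 6 * B t)))"
        using elim B_pos[of t] Ep[of t] unfolding B_def[symmetric]
        by (intro ennreal_leI mult_left_mono entropy_bound) auto
      \<comment> \<open>Both entropies grow like the square root of \<open>B t\<close>, so their
        product is linear in it. The resulting factor \<open>2 * pi / 3\<close> times 1/24 is the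
        \<open>pi / 36\<close> of the claim.\<close>
      also have "?h * (2 * sqrt (pi\<^sup>2 / 6 * B t)) = 4 * sqrt ((pi * B t / 6)\<^sup>2)"
      proof -
        have "sqrt (1 / 6 * B t) * sqrt (pi\<^sup>2 / 6 * B t) = sqrt ((1 / 6 * B t) * (pi\<^sup>2 / 6 * B t))"
          by (rule real_sqrt_mult[symmetric])
        also have "(1 / 6 * B t) * (pi\<^sup>2 / 6 * B t) = (pi * B t / 6)\<^sup>2"
          by (simp add: power2_eq_square)
        finally show ?thesis by (simp only: mult_ac)
      qed
      also have "\<dots> = 2 * pi / 3 * B t"
        using B_pos[of t] elim by simp
      finally have "(\<integral>\<^sup>+\<tau>\<in>{0..t}. (mean_perimeter L rp rm rho \<tau>)\<^sup>2 \<partial>lborel) / ennreal ((X t)\<^sup>2)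
          \<le> ennreal (2 * pi / 3 * B t) / ennreal ((X t)\<^sup>2)"
        by (rule divide_right_mono_ennreal)
      also have "\<dots> = ennreal (2 * pi / 3 * (B t / (X t)\<^sup>2))"
        using X[OF elim] B_pos[of t] elim by (simp add: divide_ennreal)
      finally show ?case .
    qed
    also have "\<dots> = ennreal (2 * pi / 3 * l)"
      using lim by (intro lim_imp_Limsup tendsto_ennrealI tendsto_intros) auto
    also have "2 * pi / 3 * l = pi / (36 * (1 - A\<^sup>2))"
      by (simp add: l_def del: right_diff_distrib_numeral)
    finally show ?thesis .
  qed
  ultimately show ?thesis unfolding X_def l_def by blast
qed

end
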